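(* Let $a\geq 1$ and $b\geq 2$ be integers. Then the set $A=\{x\in\Lambda^{a+b} : x_1+x_2+\cdots+x_{a+b}\leq b\,x_{a+b}\}$ is absorbing for $T_{a,b}$: for Lebesgue-almost every $x\in\Lambda^{a+b}$ there exists an integer $k\geq 0$ such that $T_{a,b}^k(x)\in A$.
   Context: For $n\geq 1$ let $\Lambda^n=\{x=(x_1,\ldots,x_n)\in\mathbb{R}^n : 0\leq x_1\leq x_2\leq\cdots\leq x_n\}$. For integers $a,b\geq 1$ the map $T_{a,b}:\Lambda^{a+b}\to\Lambda^{a+b}$ is defined by letting $T_{a,b}(x)$ be the vector obtained by arranging the (nonnegative) numbers $x_1,\ldots,x_a,\,x_{a+1}-x_a,\ldots,x_{a+b}-x_a$ in nondecreasing order. Measure means Lebesgue measure on $\mathbb{R}^{a+b}$. *)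

theory Defs
  imports "HOL-Analysis.Analysis"
begin

text \<open>Vectors in R^n are represented as functions nat => real on the index set {..<n}
  (0-based: coordinate x_i of the paper is x (i-1)), extensional outside {..<n},
  i.e. elements of the space of the product measure PiM {..<n} (\<lambda>_. lborel).\<close>

definition Lambda :: "nat \<Rightarrow> (nat \<Rightarrow> real) set" where
  "Lambda n = {x. (\<forall>i<n. 0 \<le> x i) \<and> (\<forall>i. i + 1 < n \<longrightarrow> x i \<le> x (i + 1))}"

definition list_to_vec :: "real list \<Rightarrow> (nat \<Rightarrow> real)" where
  "list_to_vec xs = (\<lambda>i. if i < length xs then xs ! i else undefined)"

definition T :: "nat \<Rightarrow> nat \<Rightarrow> (nat \<Rightarrow> real) \<Rightarrow> (nat \<Rightarrow> real)" where
  "T a b x = list_to_vec (sort (map x [0..<a] @ map (\<lambda>i. x i - x (a - 1)) [a..<a + b]))"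

definition A :: "nat \<Rightarrow> nat \<Rightarrow> (nat \<Rightarrow> real) set" where
  "A a b = {x \<in> Lambda (a + b). (\<Sum>i<a + b. x i) \<le> real b * x (a + b - 1)}"

end

theory Submission
  imports Defs "HOL-Combinatorics.Permutations"
begin

text \<open>Write \<open>n = a + b\<close> and let the excess of \<open>x\<close> be \<open>x_1 + ... + x_n - b x_n\<close>, so that \<open>A\<close> is
  the set of points of nonpositive excess. The excess never increases along an orbit, and it stays
  constant unless \<open>x_n < 2 x_a\<close> (the top coordinate is overtaken). The subtracted numbers \<open>x_a\<close> form
  a summable series and the excess is at most \<open>a x_a\<close>; hence an orbit that avoids \<open>A\<close> has infinitely
  many overtakings. Conversely, an orbit that has infinitely many overtakings and enters \<open>A\<close> reaches
  excess exactly \<open>0\<close>, which is a null event.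

  It remains to see that a fixed positive fraction of the points with infinitely many overtakings is
  absorbed. Up to null sets \<open>T\<close> consists of full, linear, measure preserving branches, and on each
  cylinder the weight \<open>exp (- (d_1 x_1 + ... + d_n x_n))\<close> with positive \<open>d\<close> is carried to a weight of
  the same form. In the coordinates \<open>t_j = x_j - x_{j-1}\<close> such a weight is the product of the
  \<open>exp (- c_j t_j)\<close> with \<open>c_1 >= ... >= c_n\<close>, and this monotonicity alone bounds the fraction of \<open>A\<close>
  from below, uniformly in \<open>d\<close>. No distortion or convergence estimate for the cylinders is needed.\<close>

section \<open>Lebesgue measure on functions of finitely many coordinates\<close>

abbreviation lborel_n :: "nat \<Rightarrow> (nat \<Rightarrow> real) measure" where
  "lborel_n n \<equiv> PiM {..<n} (\<lambda>_. lborel)"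

interpretation lborel_prod: product_sigma_finite "\<lambda>_ :: nat. lborel :: real measure"
  by unfold_locales

lemma nn_integral_lborel_shift:
  fixes f :: "real \<Rightarrow> ennreal"
  assumes "f \<in> borel_measurable borel"
  shows "(\<integral>\<^sup>+y. f (y + c) \<partial>lborel) = (\<integral>\<^sup>+y. f y \<partial>lborel)"
  using nn_integral_real_affine[OF assms, of 1 c] by (simp add: add.commute)

lemma borel_measurable_lborel_n_component:
  "i < n \<Longrightarrow> (\<lambda>x. x i) \<in> borel_measurable (lborel_n n)"
  using measurable_component_singleton[of i "{..<n}" "\<lambda>_. lborel :: real measure"] by simp

text \<open>Integrate over coordinate \<open>i\<close> first: once the other coordinates are fixed,
  \<open>g\<close> is constant and the exceptional set is a single point of the line.\<close>

lemma AE_lborel_n_neq: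
  assumes i: "i < n" and g[measurable]: "g \<in> borel_measurable (lborel_n n)"
    and indep: "\<And>x v. g (x(i := v)) = g x"
  shows "AE x in lborel_n n. x i \<noteq> g x"
proof -
  let ?J = "{..<n} - {i}"
  have ins: "{..<n} = insert i ?J" using i by auto
  have [measurable]: "(\<lambda>x. x i) \<in> borel_measurable (lborel_n n)"
    using i by (rule borel_measurable_lborel_n_component)
  have *: "{x \<in> space (lborel_n n). x i = g x} \<in> sets (lborel_n n)" by measurable
  have "emeasure (lborel_n n) {x \<in> space (lborel_n n). x i = g x} =
      (\<integral>\<^sup>+x. indicator {x \<in> space (lborel_n n). x i = g x} x \<partial>lborel_n n)"
    using * by simp
  also have "\<dots> = (\<integral>\<^sup>+x. indicator {0} (x i - g x) \<partial>lborel_n n)"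
    by (intro nn_integral_cong) (auto split: split_indicator)
  also have "\<dots> = (\<integral>\<^sup>+x. (\<integral>\<^sup>+y. indicator {0} ((x(i := y)) i - g (x(i := y))) \<partial>lborel) \<partial>PiM ?J (\<lambda>_. lborel))"
  proof -
    have "(\<lambda>x. indicator {0} (x i - g x)) \<in> borel_measurable (PiM (insert i ?J) (\<lambda>_. lborel))"
      unfolding ins[symmetric] by measurable
    from lborel_prod.product_nn_integral_insert[OF _ _ this] show ?thesis
      by (simp del: insert_Diff_single flip: ins)
  qed
  also have "\<dots> = (\<integral>\<^sup>+x. (\<integral>\<^sup>+y. indicator {g x} y \<partial>lborel) \<partial>PiM ?J (\<lambda>_. lborel))"
    by (intro nn_integral_cong) (auto simp: indep split: split_indicator)
  also have "\<dots> = 0" by simp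
  finally show ?thesis using * by (auto intro!: AE_I'[where N = "{x \<in> space (lborel_n n). x i = g x}"])
qed

text \<open>Each coordinate is translated by an amount depending only on earlier ones. Integrating
  out the last coordinate removes its translation, and induction treats the rest. Both
  \<open>shear\<close> and \<open>gaps\<close> are maps of this kind.\<close>

lemma nn_integral_triangular_shift:
  assumes "\<And>i. i < n \<Longrightarrow> g i \<in> borel_measurable (lborel_n i)"
    and "f \<in> borel_measurable (lborel_n n)"
  shows "(\<integral>\<^sup>+x. f (\<lambda>i\<in>{..<n}. x i + g i (restrict x {..<i})) \<partial>lborel_n n) = (\<integral>\<^sup>+x. f x \<partial>lborel_n n)"
  using assms
proof (induction n arbitrary: f)
  case 0
  show ?case
    by (intro nn_integral_cong arg_cong[where f = f]) (auto simp: space_PiM)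
next
  case (Suc n)
  let ?V = "\<lambda>n x. \<lambda>i\<in>{..<n}. x i + g i (restrict x {..<i})"
  have V: "?V (Suc n) \<in> measurable (lborel_n (Suc n)) (lborel_n (Suc n))"
  proof (intro measurable_restrict)
    fix i assume i: "i \<in> {..<Suc n}"
    have "(\<lambda>x. restrict x {..<i}) \<in> measurable (lborel_n (Suc n)) (lborel_n i)"
      using i by (intro measurable_restrict_subset) auto
    moreover have "g i \<in> borel_measurable (lborel_n i)" using i Suc.prems(1) by auto
    ultimately have [measurable]: "(\<lambda>x. g i (restrict x {..<i})) \<in> borel_measurable (lborel_n (Suc n))"
      by (rule measurable_compose)
    show "(\<lambda>x. x i + g i (restrict x {..<i})) \<in> measurable (lborel_n (Suc n)) lborel"
      using i by measurable
  qed
  note [measurable] = Suc.prems(2)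
  have ins: "{..<Suc n} = insert n {..<n}" by auto
  have n: "finite {..<n}" "n \<notin> {..<n}" by auto
  have f': "f \<in> borel_measurable (PiM (insert n {..<n}) (\<lambda>_. lborel))"
    using Suc.prems(2) by (simp only: ins)
  have fV: "(\<lambda>x. f (?V (Suc n) x)) \<in> borel_measurable (PiM (insert n {..<n}) (\<lambda>_. lborel))"
    using measurable_compose[OF V Suc.prems(2)] by (simp only: ins)
  have upd: "?V (Suc n) (x(n := y)) = (?V n x)(n := y + g n x)"
    if "x \<in> space (lborel_n n)" for x y
  proof
    fix i
    have r: "restrict x {..<n} = x" using that by (simp add: space_PiM)
    have "restrict (x(n := y)) {..<i} = restrict x {..<i}" if "i \<le> n" for i
      using that by (auto simp: restrict_def)
    then show "?V (Suc n) (x(n := y)) i = ((?V n x)(n := y + g n x)) i"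
      using r by (auto simp: less_Suc_eq)
  qed
  have sec: "(\<lambda>y. f (x(n := y))) \<in> borel_measurable borel" if "x \<in> space (lborel_n n)" for x
    using measurable_comp[OF measurable_component_update f', OF that n(2)] by (simp add: comp_def fun_upd_def)
  have Vs: "?V n x \<in> space (lborel_n n)" for x by (simp add: space_PiM)
  have "(\<integral>\<^sup>+x. f (?V (Suc n) x) \<partial>lborel_n (Suc n))
      = (\<integral>\<^sup>+x. (\<integral>\<^sup>+y. f (?V (Suc n) (x(n := y))) \<partial>lborel) \<partial>lborel_n n)"
    using lborel_prod.product_nn_integral_insert[OF n fV] by (simp only: ins)
  also have "\<dots> = (\<integral>\<^sup>+x. (\<integral>\<^sup>+y. f ((?V n x)(n := y + g n x)) \<partial>lborel) \<partial>lborel_n n)"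
    by (intro nn_integral_cong arg_cong[where f = f] upd)
  \<comment> \<open>For fixed \<open>x\<close> the inner integral only sees a translation by the
    constant \<open>g n x\<close>.\<close>
  also have "\<dots> = (\<integral>\<^sup>+x. (\<integral>\<^sup>+y. f ((?V n x)(n := y)) \<partial>lborel) \<partial>lborel_n n)"
    by (intro nn_integral_cong nn_integral_lborel_shift[of "\<lambda>y. f ((?V n _)(n := y))"] sec Vs)
  also have "\<dots> = (\<integral>\<^sup>+x. (\<integral>\<^sup>+y. f (x(n := y)) \<partial>lborel) \<partial>lborel_n n)"
  proof (rule Suc.IH[of "\<lambda>x. \<integral>\<^sup>+y. f (x(n := y)) \<partial>lborel"])
    show "(\<lambda>x. \<integral>\<^sup>+y. f (x(n := y)) \<partial>lborel) \<in> borel_measurable (lborel_n n)"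
    proof (rule lborel.borel_measurable_nn_integral)
      have "(\<lambda>p. (fst p)(n := snd p)) \<in> measurable (lborel_n n \<Otimes>\<^sub>M lborel) (PiM (insert n {..<n}) (\<lambda>_. lborel))"
        by measurable
      from measurable_compose[OF this f'] show "(\<lambda>(x, y). f (x(n := y))) \<in> borel_measurable (lborel_n n \<Otimes>\<^sub>M lborel)"
        by (simp add: split_def)
    qed
  qed (use Suc.prems(1) in auto)
  also have "\<dots> = (\<integral>\<^sup>+x. f x \<partial>lborel_n (Suc n))"
    using lborel_prod.product_nn_integral_insert[OF n f'] by (simp only: ins)
  finally show ?case .
qed

section \<open>Invariance of Lebesgue measure under permutations of the coordinates\<close>

lemma comp_permutes_in_space:
  assumes "\<sigma> permutes {..<n}" "x \<in> space (lborel_n n)"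
  shows "x \<circ> \<sigma> \<in> space (lborel_n n)"
  using assms by (auto simp: space_PiM PiE_def extensional_def permutes_not_in[OF assms(1)])

lemma measurable_comp_permutes:
  assumes "\<sigma> permutes {..<n}"
  shows "(\<lambda>x. x \<circ> \<sigma>) \<in> measurable (lborel_n n) (lborel_n n)"
proof (rule measurable_PiM_single')
  show "(\<lambda>x. (x \<circ> \<sigma>) i) \<in> measurable (lborel_n n) lborel" if "i \<in> {..<n}" for i
    using permutes_in_image[OF assms, of i] that by (auto intro!: measurable_component_singleton)
qed (use comp_permutes_in_space[OF assms] in \<open>auto simp: space_PiM comp_def\<close>)

text \<open>It suffices to compare the measures on boxes. The preimage of a box is the box with its
  sides rearranged by \<open>inv \<sigma>\<close>, and the product of the side measures ignores the
  order of the factors.\<close>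

lemma distr_comp_permutes:
  assumes \<sigma>: "\<sigma> permutes {..<n}"
  shows "distr (lborel_n n) (lborel_n n) (\<lambda>x. x \<circ> \<sigma>) = lborel_n n"
proof (rule lborel_prod.PiM_eqI)
  fix B :: "nat \<Rightarrow> real set"
  assume B: "\<And>i. i \<in> {..<n} \<Longrightarrow> B i \<in> sets lborel"
  let ?\<tau> = "inv \<sigma>"
  have \<tau>: "?\<tau> permutes {..<n}" using \<sigma> by (rule permutes_inv)
  have "(\<lambda>x. x \<circ> \<sigma>) -` (PiE {..<n} B) \<inter> space (lborel_n n) = PiE {..<n} (B \<circ> ?\<tau>)"
  proof (intro set_eqI iffI)
    fix x assume x: "x \<in> (\<lambda>x. x \<circ> \<sigma>) -` (PiE {..<n} B) \<inter> space (lborel_n n)"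
    have "x i \<in> B (?\<tau> i)" if "i < n" for i
    proof -
      have "?\<tau> i < n" using permutes_in_image[OF \<tau>, of i] that by simp
      then have "x (\<sigma> (?\<tau> i)) \<in> B (?\<tau> i)" using x by (auto simp: PiE_iff)
      then show ?thesis by (simp add: permutes_inverses[OF \<sigma>])
    qed
    then show "x \<in> PiE {..<n} (B \<circ> ?\<tau>)" using x by (auto simp: space_PiM PiE_iff)
  next
    fix x assume x: "x \<in> PiE {..<n} (B \<circ> ?\<tau>)"
    then have sp: "x \<in> space (lborel_n n)" by (auto simp: space_PiM PiE_iff)
    have "x (\<sigma> i) \<in> B i" if "i < n" for i
    proof -
      have "\<sigma> i < n" using permutes_in_image[OF \<sigma>, of i] that by simp
      then have "x (\<sigma> i) \<in> B (?\<tau> (\<sigma> i))" using x by (auto simp: PiE_iff)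
      then show ?thesis by (simp add: permutes_inverses[OF \<sigma>])
    qed
    then show "x \<in> (\<lambda>x. x \<circ> \<sigma>) -` (PiE {..<n} B) \<inter> space (lborel_n n)"
      using sp comp_permutes_in_space[OF \<sigma> sp] by (auto simp: space_PiM PiE_iff)
  qed
  moreover have "PiE {..<n} B \<in> sets (lborel_n n)"
    using B by (intro sets_PiM_I_finite) auto
  ultimately have "emeasure (distr (lborel_n n) (lborel_n n) (\<lambda>x. x \<circ> \<sigma>)) (PiE {..<n} B)
      = emeasure (lborel_n n) (PiE {..<n} (B \<circ> ?\<tau>))"
    using measurable_comp_permutes[OF \<sigma>] by (subst emeasure_distr) auto
  also have "\<dots> = (\<Prod>i<n. emeasure lborel (B (?\<tau> i)))"
    using B permutes_in_image[OF \<tau>] by (subst lborel_prod.emeasure_PiM) auto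
  also have "\<dots> = (\<Prod>i<n. emeasure lborel (B i))"
    using prod.permute[OF \<tau>, of "\<lambda>i. emeasure lborel (B i)"] by (simp add: comp_def)
  finally show "emeasure (distr (lborel_n n) (lborel_n n) (\<lambda>x. x \<circ> \<sigma>)) (PiE {..<n} B)
      = (\<Prod>i<n. emeasure lborel (B i))" .
qed auto

lemma nn_integral_comp_permutes:
  assumes "\<sigma> permutes {..<n}" "f \<in> borel_measurable (lborel_n n)"
  shows "(\<integral>\<^sup>+x. f (x \<circ> \<sigma>) \<partial>lborel_n n) = (\<integral>\<^sup>+x. f x \<partial>lborel_n n)"
  using nn_integral_distr[OF measurable_comp_permutes[OF assms(1)], of f] assms(2)
  by (simp add: distr_comp_permutes[OF assms(1)])

section \<open>Sorting a random vector\<close>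

definition sort_vec :: "nat \<Rightarrow> (nat \<Rightarrow> real) \<Rightarrow> nat \<Rightarrow> real" where
  "sort_vec n z = list_to_vec (sort (map z [0..<n]))"

text \<open>Strictness excludes ties, so that only one permutation can bring a given vector into
  this form.\<close>

definition strict_vec :: "nat \<Rightarrow> (nat \<Rightarrow> real) \<Rightarrow> bool" where
  "strict_vec n y \<longleftrightarrow> (\<forall>j<n. \<forall>i<j. y i < y j)"

lemma list_to_vec_permute_list:
  assumes z: "z \<in> space (lborel_n n)" and \<sigma>: "\<sigma> permutes {..<n}"
  shows "list_to_vec (permute_list \<sigma> (map z [0..<n])) = z \<circ> \<sigma>"
proof
  fix i
  show "list_to_vec (permute_list \<sigma> (map z [0..<n])) i = (z \<circ> \<sigma>) i"
  proof (cases "i < n")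
    case True
    then have "\<sigma> i < n" using permutes_in_image[OF \<sigma>, of i] by simp
    with True show ?thesis
      by (simp add: list_to_vec_def permute_list_nth \<sigma>)
  next
    case False
    then show ?thesis
      using z by (auto simp: list_to_vec_def permutes_not_in[OF \<sigma>] space_PiM PiE_def extensional_def)
  qed
qed

text \<open>The sorted list with a given multiset of entries is unique, so any sorting permutation
  yields the same vector, even when there are ties.\<close>

lemma sort_vec_eqI:
  assumes z: "z \<in> space (lborel_n n)" and \<sigma>: "\<sigma> permutes {..<n}"
    and mono: "\<And>i j. i \<le> j \<Longrightarrow> j < n \<Longrightarrow> z (\<sigma> i) \<le> z (\<sigma> j)"
  shows "sort_vec n z = z \<circ> \<sigma>"
proof -
  have "sorted (permute_list \<sigma> (map z [0..<n]))"
  proof (rule sorted_iff_nth_mono[THEN iffD2], intro allI impI)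
    fix i j assume ij: "i \<le> j" "j < length (permute_list \<sigma> (map z [0..<n]))"
    have "\<sigma> i < n" "\<sigma> j < n" using permutes_in_image[OF \<sigma>] ij by auto
    then show "permute_list \<sigma> (map z [0..<n]) ! i \<le> permute_list \<sigma> (map z [0..<n]) ! j"
      using ij mono[of i j] by (simp add: permute_list_nth \<sigma>)
  qed
  then have "sort (map z [0..<n]) = permute_list \<sigma> (map z [0..<n])"
    by (intro properties_for_sort) (simp_all add: \<sigma>)
  then show ?thesis unfolding sort_vec_def by (simp only: list_to_vec_permute_list[OF z \<sigma>])
qed

lemma sort_vec_permutation:
  assumes z: "z \<in> space (lborel_n n)"
  obtains \<sigma> where "\<sigma> permutes {..<n}" "sort_vec n z = z \<circ> \<sigma>"
proof -
  have "mset (sort (map z [0..<n])) = mset (map z [0..<n])" by simp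
  then obtain \<sigma> where \<sigma>: "\<sigma> permutes {..<length (map z [0..<n])}"
    "permute_list \<sigma> (map z [0..<n]) = sort (map z [0..<n])"
    by (rule mset_eq_permutation)
  then have p: "\<sigma> permutes {..<n}" by simp
  have "sort_vec n z = z \<circ> \<sigma>"
    using list_to_vec_permute_list[OF z p] \<sigma>(2) by (simp only: sort_vec_def)
  with p show ?thesis by (rule that)
qed

lemma sort_vec_mono:
  assumes "i \<le> j" "j < n"
  shows "sort_vec n z i \<le> sort_vec n z j"
  using assms sorted_nth_mono[OF sorted_sort, of i j "map z [0..<n]"]
  by (simp add: sort_vec_def list_to_vec_def)

text \<open>The space is a finite union of closed regions, one for each permutation that sorts the
  vector, and on each region sorting is a fixed permutation of coordinates.\<close>

lemma sort_vec_measurable: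
  "sort_vec n \<in> measurable (lborel_n n) (lborel_n n)"
proof (rule measurableI)
  show "sort_vec n z \<in> space (lborel_n n)" if z: "z \<in> space (lborel_n n)" for z
    by (rule sort_vec_permutation[OF z]) (simp add: comp_permutes_in_space z)
next
  fix B assume B: "B \<in> sets (lborel_n n)"
  let ?P = "{\<sigma>. \<sigma> permutes {..<n}}"
  let ?E = "\<lambda>\<sigma>. {z \<in> space (lborel_n n). (\<forall>j\<in>{..<n}. \<forall>i\<in>{..j}. z (\<sigma> i) \<le> z (\<sigma> j)) \<and> z \<circ> \<sigma> \<in> B}"
  have "sort_vec n -` B \<inter> space (lborel_n n) = (\<Union>\<sigma>\<in>?P. ?E \<sigma>)" (is "?L = ?R")
  proof (intro equalityI subsetI)
    fix z assume z: "z \<in> ?L"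
    then have zs: "z \<in> space (lborel_n n)" by simp
    from sort_vec_permutation[OF zs] obtain \<sigma> where \<sigma>: "\<sigma> permutes {..<n}" "sort_vec n z = z \<circ> \<sigma>" .
    have "z (\<sigma> i) \<le> z (\<sigma> j)" if "i \<le> j" "j < n" for i j
      using sort_vec_mono[OF that, of z] \<sigma>(2) by simp
    with z \<sigma> show "z \<in> ?R" by auto
  next
    fix z assume "z \<in> ?R"
    then obtain \<sigma> where \<sigma>: "\<sigma> permutes {..<n}" and z: "z \<in> ?E \<sigma>" by auto
    then show "z \<in> ?L" using sort_vec_eqI[of z n \<sigma>] by auto
  qed
  moreover have "?E \<sigma> \<in> sets (lborel_n n)" if \<sigma>: "\<sigma> permutes {..<n}" for \<sigma>
  proof -
    have [measurable]: "(\<lambda>z. z (\<sigma> i)) \<in> borel_measurable (lborel_n n)" if "i < n" for i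
      using permutes_in_image[OF \<sigma>, of i] that by (auto intro: borel_measurable_lborel_n_component)
    have "{z \<in> space (lborel_n n). \<forall>j\<in>{..<n}. \<forall>i\<in>{..j}. z (\<sigma> i) \<le> z (\<sigma> j)} \<in> sets (lborel_n n)"
      by (intro sets.sets_Collect_finite_All borel_measurable_le) auto
    moreover have "{z \<in> space (lborel_n n). z \<circ> \<sigma> \<in> B} \<in> sets (lborel_n n)"
      using measurable_sets[OF measurable_comp_permutes[OF \<sigma>] B] by (simp add: vimage_def Int_def conj_commute)
    ultimately show ?thesis by (intro sets.sets_Collect_conj)
  qed
  ultimately show "sort_vec n -` B \<inter> space (lborel_n n) \<in> sets (lborel_n n)"
    by (auto intro!: sets.finite_UN finite_permutations)
qed

lemma AE_lborel_n_inj_on: "AE z in lborel_n n. inj_on z {..<n}"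
proof -
  have "AE z in lborel_n n. i \<noteq> j \<longrightarrow> z i \<noteq> z j" if "i \<in> {..<n}" "j \<in> {..<n}" for i j
  proof (cases "i = j")
    case False
    then have "AE z in lborel_n n. z i \<noteq> z j"
      using that by (intro AE_lborel_n_neq borel_measurable_lborel_n_component) auto
    then show ?thesis by auto
  qed auto
  then have "AE z in lborel_n n. \<forall>i\<in>{..<n}. \<forall>j\<in>{..<n}. i \<noteq> j \<longrightarrow> z i \<noteq> z j"
    by (intro AE_ball_countable[THEN iffD2] ballI) auto
  then show ?thesis by eventually_elim (auto simp: inj_on_def)
qed

lemma strict_vec_sets: "{y \<in> space (lborel_n n). strict_vec n y} \<in> sets (lborel_n n)"
proof -
  have "{y \<in> space (lborel_n n). \<forall>j\<in>{..<n}. \<forall>i\<in>{..<j}. y i < y j} \<in> sets (lborel_n n)"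
    by (intro sets.sets_Collect_finite_All borel_measurable_less borel_measurable_lborel_n_component) auto
  then show ?thesis by (simp add: strict_vec_def lessThan_def)
qed

text \<open>Change of variables for sorting. Almost every \<open>z\<close> has distinct coordinates,
  so exactly one \<open>\<sigma>\<close> makes \<open>z \<circ> \<sigma>\<close> strictly increasing
  and the sum over permutations has one nonzero term. Permutation invariance then turns each
  \<open>z \<circ> \<sigma>\<close> into a free variable \<open>y\<close>.\<close>

lemma nn_integral_sort_vec:
  fixes f H :: "(nat \<Rightarrow> real) \<Rightarrow> ennreal"
  assumes f: "f \<in> borel_measurable (lborel_n n)" and H: "H \<in> borel_measurable (lborel_n n)"
  shows "(\<integral>\<^sup>+z. f z * H (sort_vec n z) \<partial>lborel_n n) =
    (\<Sum>\<sigma> | \<sigma> permutes {..<n}. \<integral>\<^sup>+y. indicator {y. strict_vec n y} y * f (y \<circ> inv \<sigma>) * H y \<partial>lborel_n n)"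
proof -
  let ?P = "{\<sigma>. \<sigma> permutes {..<n}}"
  let ?g = "\<lambda>\<sigma> y. indicator {y. strict_vec n y} y * f (y \<circ> inv \<sigma>) * H y"
  have fin: "finite ?P" by (simp add: finite_permutations)
  have g: "?g \<sigma> \<in> borel_measurable (lborel_n n)" if \<sigma>: "\<sigma> permutes {..<n}" for \<sigma>
  proof -
    note [measurable] = H
    have [measurable]: "(\<lambda>y. f (y \<circ> inv \<sigma>)) \<in> borel_measurable (lborel_n n)"
      using measurable_compose[OF measurable_comp_permutes[OF permutes_inv[OF \<sigma>]] f] .
    have [measurable]: "Measurable.pred (lborel_n n) (strict_vec n)"
      using strict_vec_sets by (simp add: pred_def)
    show ?thesis by measurable
  qed
  have "AE z in lborel_n n. f z * H (sort_vec n z) = (\<Sum>\<sigma>\<in>?P. ?g \<sigma> (z \<circ> \<sigma>))"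
    using AE_lborel_n_inj_on AE_space
  proof eventually_elim
    fix z assume inj: "inj_on z {..<n}" and z: "z \<in> space (lborel_n n)"
    from sort_vec_permutation[OF z] obtain \<sigma> where \<sigma>: "\<sigma> permutes {..<n}" "sort_vec n z = z \<circ> \<sigma>" .
    have str: "strict_vec n (z \<circ> \<sigma>)"
      unfolding strict_vec_def
    proof (intro allI impI)
      fix i j assume ij: "j < n" "i < j"
      have "\<sigma> i < n" "\<sigma> j < n" using ij permutes_in_image[OF \<sigma>(1)] by auto
      moreover have "\<sigma> i \<noteq> \<sigma> j" using ij permutes_inj[OF \<sigma>(1)] by (auto dest: injD)
      ultimately have "z (\<sigma> i) \<noteq> z (\<sigma> j)" using inj by (auto dest: inj_onD)
      moreover have "z (\<sigma> i) \<le> z (\<sigma> j)" using sort_vec_mono[of i j n z] ij \<sigma>(2) by simp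
      ultimately show "(z \<circ> \<sigma>) i < (z \<circ> \<sigma>) j" by simp
    qed
    \<comment> \<open>Both permutations sort \<open>z\<close>, so they give the same vector, and
      injectivity of \<open>z\<close> recovers the permutation from it.\<close>
    have uniq: "\<tau> = \<sigma>" if \<tau>: "\<tau> permutes {..<n}" and s: "strict_vec n (z \<circ> \<tau>)" for \<tau>
    proof -
      have "z (\<tau> i) \<le> z (\<tau> j)" if "i \<le> j" "j < n" for i j
        using s that by (cases "i = j") (auto simp: strict_vec_def less_imp_le)
      from sort_vec_eqI[OF z \<tau> this] have eq: "z \<circ> \<tau> = z \<circ> \<sigma>" using \<sigma>(2) by simp
      show ?thesis
      proof
        fix i show "\<tau> i = \<sigma> i"
        proof (cases "i < n")
          case True
          then have "\<sigma> i \<in> {..<n}" "\<tau> i \<in> {..<n}"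
            using permutes_in_image[OF \<sigma>(1)] permutes_in_image[OF \<tau>] by auto
          with inj fun_cong[OF eq, of i] show ?thesis by (auto dest: inj_onD)
        qed (simp add: permutes_not_in[OF \<tau>] permutes_not_in[OF \<sigma>(1)])
      qed
    qed
    have "(\<Sum>\<tau>\<in>?P. ?g \<tau> (z \<circ> \<tau>)) = (\<Sum>\<tau>\<in>{\<sigma>}. ?g \<tau> (z \<circ> \<tau>))"
      using fin \<sigma>(1) uniq by (intro sum.mono_neutral_right) (auto split: split_indicator)
    also have "\<dots> = f z * H (sort_vec n z)"
      using str \<sigma> by (simp add: comp_assoc permutes_inv_o)
    finally show "f z * H (sort_vec n z) = (\<Sum>\<sigma>\<in>?P. ?g \<sigma> (z \<circ> \<sigma>))" by simp
  qed
  then have "(\<integral>\<^sup>+z. f z * H (sort_vec n z) \<partial>lborel_n n) = (\<integral>\<^sup>+z. (\<Sum>\<sigma>\<in>?P. ?g \<sigma> (z \<circ> \<sigma>)) \<partial>lborel_n n)"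
    by (rule nn_integral_cong_AE)
  also have "\<dots> = (\<Sum>\<sigma>\<in>?P. \<integral>\<^sup>+z. ?g \<sigma> (z \<circ> \<sigma>) \<partial>lborel_n n)"
    by (intro nn_integral_sum measurable_compose[OF measurable_comp_permutes g]) auto
  also have "\<dots> = (\<Sum>\<sigma>\<in>?P. \<integral>\<^sup>+y. ?g \<sigma> y \<partial>lborel_n n)"
    by (intro sum.cong refl nn_integral_comp_permutes g) auto
  finally show ?thesis .
qed

section \<open>Branches of the algorithm\<close>

text \<open>Exponentials of linear forms: linear changes of variables only alter the coefficients
  \<open>d\<close>, so the family is closed under passing to the branches of
  \<open>T\<close>.\<close>

definition weight :: "nat \<Rightarrow> (nat \<Rightarrow> real) \<Rightarrow> (nat \<Rightarrow> real) \<Rightarrow> ennreal" where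
  "weight n d x = ennreal (exp (- (\<Sum>i<n. d i * x i)))"

lemma weight_measurable [measurable]: "weight n d \<in> borel_measurable (lborel_n n)"
proof -
  have [measurable]: "(\<lambda>x. \<Sum>i<n. d i * x i) \<in> borel_measurable (lborel_n n)"
    by (intro borel_measurable_sum borel_measurable_times borel_measurable_lborel_n_component) auto
  show ?thesis unfolding weight_def by measurable
qed

lemma weight_comp_permutes:
  assumes "\<sigma> permutes {..<n}"
  shows "weight n d (y \<circ> inv \<sigma>) = weight n (d \<circ> \<sigma>) y"
proof -
  have "(\<Sum>i<n. d i * y (inv \<sigma> i)) = (\<Sum>i<n. d (\<sigma> i) * y (inv \<sigma> (\<sigma> i)))"
    using sum.permute[OF assms, of "\<lambda>i. d i * y (inv \<sigma> i)"] by (simp add: comp_def)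
  then show ?thesis by (simp add: weight_def permutes_inverses[OF assms])
qed

lemma Lambda_iff: "x \<in> Lambda n \<longleftrightarrow> (\<forall>i<n. 0 \<le> x i) \<and> (\<forall>j<n. \<forall>i\<le>j. x i \<le> x j)"
proof -
  have "x i \<le> x j" if "\<forall>i. i + 1 < n \<longrightarrow> x i \<le> x (i + 1)" "i \<le> j" "j < n" for i j
    using that(2,3,1)
  proof (induction j rule: dec_induct)
    case (step m)
    then have "x i \<le> x m" "x m \<le> x (m + 1)" by auto
    then show ?case by simp
  qed simp
  then show ?thesis unfolding Lambda_def by auto
qed

lemma Lambda_sets: "{x \<in> space (lborel_n n). x \<in> Lambda n} \<in> sets (lborel_n n)"
proof -
  have "{x \<in> space (lborel_n n). (\<forall>i\<in>{..<n}. 0 \<le> x i) \<and> (\<forall>j\<in>{..<n}. \<forall>i\<in>{..j}. x i \<le> x j)} \<in> sets (lborel_n n)"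
    by (intro sets.sets_Collect_conj sets.sets_Collect_finite_All borel_measurable_le
        borel_measurable_lborel_n_component) auto
  then show ?thesis by (simp only: Lambda_iff Ball_def lessThan_iff atMost_iff)
qed

text \<open>A predicate that only looks at the relative order of the coordinates is constant on each branch,
  that is, on each set of vectors sorted by a given permutation (up to ties).\<close>

definition order_determined :: "nat \<Rightarrow> ((nat \<Rightarrow> real) \<Rightarrow> bool) \<Rightarrow> bool" where
  "order_determined n Q \<longleftrightarrow>
    (\<forall>y y'. (\<forall>i<n. \<forall>j<n. y i \<le> y j \<longleftrightarrow> y' i \<le> y' j) \<longrightarrow> Q y = Q y')"

text \<open>A strictly increasing \<open>y\<close> orders its entries as their indices are ordered,
  so \<open>y \<circ> \<tau>\<close> has the same relative order as \<open>\<tau>\<close> itself.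
  Whether \<open>Q\<close> holds therefore depends on \<open>\<tau>\<close> alone.\<close>

lemma order_determined_strict_vec:
  assumes Q: "order_determined n Q" and \<tau>: "\<tau> permutes {..<n}" and y: "strict_vec n y"
  shows "Q (y \<circ> \<tau>) = Q (\<lambda>i. real (\<tau> i))"
proof -
  have *: "y i \<le> y j \<longleftrightarrow> real i \<le> real j" if "i < n" "j < n" for i j
    using y that unfolding strict_vec_def
    by (cases i j rule: linorder_cases) (force simp: not_le)+
  have "\<tau> i < n" if "i < n" for i using permutes_in_image[OF \<tau>] that by simp
  then have "\<forall>i<n. \<forall>j<n. (y \<circ> \<tau>) i \<le> (y \<circ> \<tau>) j \<longleftrightarrow> real (\<tau> i) \<le> real (\<tau> j)"
    using * by simp
  then show ?thesis
    by (intro Q[unfolded order_determined_def, THEN spec, THEN spec, THEN mp])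
qed

lemma strict_vec_nonneg_iff:
  assumes "strict_vec n y" and \<sigma>: "\<sigma> permutes {..<n}"
  shows "(\<forall>i<n. 0 \<le> (y \<circ> inv \<sigma>) i) \<longleftrightarrow> y \<in> Lambda n"
proof -
  have "(\<forall>i<n. 0 \<le> (y \<circ> inv \<sigma>) i) \<longleftrightarrow> (\<forall>i<n. 0 \<le> y i)"
  proof safe
    fix i assume "\<forall>i<n. 0 \<le> (y \<circ> inv \<sigma>) i" "i < n"
    moreover from \<open>i < n\<close> have "\<sigma> i < n" using permutes_in_image[OF \<sigma>] by simp
    ultimately have "0 \<le> (y \<circ> inv \<sigma>) (\<sigma> i)" by blast
    then show "0 \<le> y i" by (simp add: permutes_inverses[OF \<sigma>])
  next
    fix i assume "\<forall>i<n. 0 \<le> y i" "i < n"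
    moreover from \<open>i < n\<close> have "inv \<sigma> i < n" using permutes_in_image[OF permutes_inv[OF \<sigma>]] by simp
    ultimately show "0 \<le> (y \<circ> inv \<sigma>) i" by simp
  qed
  moreover have "y i \<le> y j" if "i \<le> j" "j < n" for i j
    using assms(1) that by (cases "i = j") (auto simp: strict_vec_def less_imp_le)
  ultimately show ?thesis by (auto simp: Lambda_iff)
qed

text \<open>Points of \<open>Lambda\<close> with ties lie in finitely many null hyperplanes, so the
  weak and the strict chamber are interchangeable under the integral.\<close>

lemma AE_Lambda_strict_vec: "AE y in lborel_n n. y \<in> Lambda n \<longrightarrow> strict_vec n y"
  using AE_lborel_n_inj_on
proof eventually_elim
  fix y :: "nat \<Rightarrow> real" assume inj: "inj_on y {..<n}"
  have "y i < y j" if "y \<in> Lambda n" "j < n" "i < j" for i j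
  proof -
    have "y i \<le> y j" "y i \<noteq> y j" using that inj by (auto simp: Lambda_iff dest: inj_onD)
    then show ?thesis by simp
  qed
  then show "y \<in> Lambda n \<longrightarrow> strict_vec n y" by (auto simp: strict_vec_def)
qed

lemma weight_nonneg_measurable:
  assumes "{z \<in> space (lborel_n n). Q z} \<in> sets (lborel_n n)"
  shows "(\<lambda>z. weight n d z * indicator {z. (\<forall>i<n. 0 \<le> z i) \<and> Q z} z)
    \<in> borel_measurable (lborel_n n)"
proof -
  have "{z \<in> space (lborel_n n). (\<forall>i\<in>{..<n}. 0 \<le> z i) \<and> Q z} \<in> sets (lborel_n n)"
    by (intro sets.sets_Collect_conj sets.sets_Collect_finite_All borel_measurable_le
        borel_measurable_lborel_n_component assms) auto
  moreover have "{z \<in> space (lborel_n n). (\<forall>i\<in>{..<n}. 0 \<le> z i) \<and> Q z} =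
      {z. (\<forall>i<n. 0 \<le> z i) \<and> Q z} \<inter> space (lborel_n n)"
    by auto
  ultimately have "{z. (\<forall>i<n. 0 \<le> z i) \<and> Q z} \<inter> space (lborel_n n) \<in> sets (lborel_n n)"
    by (simp only:)
  then show ?thesis
    by (intro borel_measurable_times_ennreal weight_measurable borel_measurable_indicator_iff[THEN iffD2])
qed

text \<open>The predicate \<open>Q\<close> selects entire permutations. Each selected one
  contributes an integral over all of \<open>Lambda n\<close>, which is what makes the branches
  full.\<close>

lemma nn_integral_order_determined_sort_vec:
  fixes H :: "(nat \<Rightarrow> real) \<Rightarrow> ennreal"
  assumes H: "H \<in> borel_measurable (lborel_n n)"
    and Q: "order_determined n Q" and Qm: "{z \<in> space (lborel_n n). Q z} \<in> sets (lborel_n n)"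
  shows "(\<integral>\<^sup>+z. weight n d z * indicator {z. (\<forall>i<n. 0 \<le> z i) \<and> Q z} z * H (sort_vec n z) \<partial>lborel_n n) =
    (\<Sum>\<sigma> | \<sigma> permutes {..<n} \<and> Q (\<lambda>i. real (inv \<sigma> i)).
      \<integral>\<^sup>+y. weight n (d \<circ> \<sigma>) y * indicator (Lambda n) y * H y \<partial>lborel_n n)"
proof -
  let ?f = "\<lambda>z. weight n d z * indicator {z. (\<forall>i<n. 0 \<le> z i) \<and> Q z} z"
  have f: "?f \<in> borel_measurable (lborel_n n)"
    by (rule weight_nonneg_measurable[OF Qm])
  have fin: "finite {\<sigma>. \<sigma> permutes {..<n}}" by (simp add: finite_permutations)
  have "(\<integral>\<^sup>+z. ?f z * H (sort_vec n z) \<partial>lborel_n n) =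
    (\<Sum>\<sigma> | \<sigma> permutes {..<n}.
      \<integral>\<^sup>+y. indicator {y. strict_vec n y} y * ?f (y \<circ> inv \<sigma>) * H y \<partial>lborel_n n)"
    by (rule nn_integral_sort_vec[OF f H])
  also have "\<dots> = (\<Sum>\<sigma> | \<sigma> permutes {..<n}. if Q (\<lambda>i. real (inv \<sigma> i))
      then \<integral>\<^sup>+y. weight n (d \<circ> \<sigma>) y * indicator (Lambda n) y * H y \<partial>lborel_n n else 0)"
  proof (intro sum.cong refl)
    fix \<sigma> assume "\<sigma> \<in> {\<sigma>. \<sigma> permutes {..<n}}"
    then have \<sigma>: "\<sigma> permutes {..<n}" by simp
    have "(\<integral>\<^sup>+y. indicator {y. strict_vec n y} y * ?f (y \<circ> inv \<sigma>) * H y \<partial>lborel_n n)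
        = (\<integral>\<^sup>+y. (if Q (\<lambda>i. real (inv \<sigma> i)) then weight n (d \<circ> \<sigma>) y * indicator (Lambda n) y * H y else 0)
             \<partial>lborel_n n)"
    proof (rule nn_integral_cong_AE)
      show "AE y in lborel_n n. indicator {y. strict_vec n y} y * ?f (y \<circ> inv \<sigma>) * H y
        = (if Q (\<lambda>i. real (inv \<sigma> i)) then weight n (d \<circ> \<sigma>) y * indicator (Lambda n) y * H y else 0)"
        using AE_Lambda_strict_vec
      proof eventually_elim
        fix y assume L: "y \<in> Lambda n \<longrightarrow> strict_vec n y"
        show "indicator {y. strict_vec n y} y * ?f (y \<circ> inv \<sigma>) * H y
          = (if Q (\<lambda>i. real (inv \<sigma> i)) then weight n (d \<circ> \<sigma>) y * indicator (Lambda n) y * H y else 0)"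
        proof (cases "strict_vec n y")
          case True
          have q: "Q (y \<circ> inv \<sigma>) = Q (\<lambda>i. real (inv \<sigma> i))"
            by (rule order_determined_strict_vec[OF Q permutes_inv[OF \<sigma>] True])
          show ?thesis
            unfolding weight_comp_permutes[OF \<sigma>] indicator_def mem_Collect_eq
              strict_vec_nonneg_iff[OF True \<sigma>] q
            using True by simp
        qed (use L in auto)
      qed
    qed
    then show "(\<integral>\<^sup>+y. indicator {y. strict_vec n y} y * ?f (y \<circ> inv \<sigma>) * H y \<partial>lborel_n n)
        = (if Q (\<lambda>i. real (inv \<sigma> i))
      then \<integral>\<^sup>+y. weight n (d \<circ> \<sigma>) y * indicator (Lambda n) y * H y \<partial>lborel_n n else 0)"
      by simp
  qed
  also have "\<dots> = (\<Sum>\<sigma> | \<sigma> permutes {..<n} \<and> Q (\<lambda>i. real (inv \<sigma> i)).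
      \<integral>\<^sup>+y. weight n (d \<circ> \<sigma>) y * indicator (Lambda n) y * H y \<partial>lborel_n n)"
    by (subst sum.inter_filter[OF fin, symmetric]) simp
  finally show ?thesis .
qed

section \<open>The map as a linear shear followed by sorting\<close>

definition shear :: "nat \<Rightarrow> nat \<Rightarrow> (nat \<Rightarrow> real) \<Rightarrow> nat \<Rightarrow> real" where
  "shear a n x = (\<lambda>i\<in>{..<n}. x i - (if a \<le> i then x (a - 1) else 0))"

lemma T_eq_sort_vec: "T a b x = sort_vec (a + b) (shear a (a + b) x)"
proof -
  have "map (shear a (a + b) x) [0..<a + b] = map x [0..<a] @ map (\<lambda>i. x i - x (a - 1)) [a..<a + b]"
    by (intro nth_equalityI) (auto simp: shear_def nth_append)
  then show ?thesis by (simp add: T_def sort_vec_def)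
qed

lemma shear_measurable:
  assumes "1 \<le> a" "a \<le> n"
  shows "shear a n \<in> measurable (lborel_n n) (lborel_n n)"
  unfolding shear_def
proof (intro measurable_restrict)
  fix i assume "i \<in> {..<n}"
  then have [measurable]: "(\<lambda>x. x i) \<in> borel_measurable (lborel_n n)"
     "(\<lambda>x. x (a - 1)) \<in> borel_measurable (lborel_n n)"
    using assms by (auto intro: borel_measurable_lborel_n_component)
  show "(\<lambda>x. x i - (if a \<le> i then x (a - 1) else 0)) \<in> measurable (lborel_n n) lborel"
    by measurable
qed

text \<open>Since \<open>a \<ge> 1\<close>, the subtracted coordinate \<open>a - 1\<close> precedes
  every coordinate it is subtracted from, so the shear is a triangular shift.\<close>

lemma nn_integral_shear:
  assumes "1 \<le> a" and f: "f \<in> borel_measurable (lborel_n n)"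
  shows "(\<integral>\<^sup>+x. f (shear a n x) \<partial>lborel_n n) = (\<integral>\<^sup>+x. f x \<partial>lborel_n n)"
proof -
  let ?g = "\<lambda>i x. if a \<le> i then - x (a - 1) else (0 :: real)"
  have "shear a n x = (\<lambda>i\<in>{..<n}. x i + ?g i (restrict x {..<i}))" for x
    using assms(1) by (auto simp: shear_def fun_eq_iff)
  moreover have "?g i \<in> borel_measurable (lborel_n i)" for i
    using assms(1) by (cases "a \<le> i") (auto intro!: borel_measurable_uminus borel_measurable_lborel_n_component)
  ultimately show ?thesis using nn_integral_triangular_shift[of n ?g f] f by simp
qed

lemma T_measurable:
  assumes "1 \<le> a"
  shows "T a b \<in> measurable (lborel_n (a + b)) (lborel_n (a + b))"
proof -
  have eq: "T a b = sort_vec (a + b) \<circ> shear a (a + b)" by (auto simp: T_eq_sort_vec)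
  have "shear a (a + b) \<in> measurable (lborel_n (a + b)) (lborel_n (a + b))"
    using assms by (intro shear_measurable) auto
  then show ?thesis unfolding eq by (rule measurable_comp[OF _ sort_vec_measurable])
qed

text \<open>The dual action on coefficients: what the coordinates from \<open>a\<close> on lose is a
  multiple of \<open>x (a - 1)\<close>, and the enlarged coefficient at \<open>a - 1\<close>
  restores it.\<close>

lemma weight_shear:
  assumes "1 \<le> a" "a \<le> n"
  shows "weight n (d(a - 1 := d (a - 1) + (\<Sum>i=a..<n. d i))) (shear a n x) = weight n d x"
proof -
  define D where "D = (\<Sum>i=a..<n. d i)"
  have "(\<Sum>i<n. (d(a - 1 := d (a - 1) + D)) i * shear a n x i)
      = (\<Sum>i<n. d i * x i + (if i = a - 1 then D * x (a - 1) else 0) - (if a \<le> i then d i * x (a - 1) else 0))"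
    using assms by (intro sum.cong) (auto simp: shear_def algebra_simps)
  also have "\<dots> = (\<Sum>i<n. d i * x i) + (\<Sum>i<n. if i = a - 1 then D * x (a - 1) else 0)
      - (\<Sum>i<n. if a \<le> i then d i * x (a - 1) else 0)"
    by (simp add: sum.distrib sum_subtractf)
  also have "(\<Sum>i<n. if i = a - 1 then D * x (a - 1) else 0) = D * x (a - 1)"
    using assms by simp
  also have "(\<Sum>i<n. if a \<le> i then d i * x (a - 1) else 0) = (\<Sum>i\<in>{i\<in>{..<n}. a \<le> i}. d i * x (a - 1))"
    by (rule sum.inter_filter[symmetric]) simp
  also have "{i\<in>{..<n}. a \<le> i} = {a..<n}" by auto
  also have "(\<Sum>i\<in>{a..<n}. d i * x (a - 1)) = D * x (a - 1)"
    by (simp add: D_def sum_distrib_right)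
  finally show ?thesis by (simp add: weight_def D_def)
qed

text \<open>The transfer operator of \<open>T\<close> on a weight, tested against \<open>H\<close>.
  Every branch produces a weight of the same form on all of \<open>Lambda\<close>, with coefficients
  \<open>d'\<close> permuted by the branch.\<close>

lemma nn_integral_branches:
  fixes H :: "(nat \<Rightarrow> real) \<Rightarrow> ennreal" and d :: "nat \<Rightarrow> real"
  assumes a: "1 \<le> a" and H: "H \<in> borel_measurable (lborel_n (a + b))"
    and Q: "order_determined (a + b) Q"
    and Qm: "{z \<in> space (lborel_n (a + b)). Q z} \<in> sets (lborel_n (a + b))"
    and P: "\<And>x. x \<in> P \<longleftrightarrow> (\<forall>i<a + b. 0 \<le> shear a (a + b) x i) \<and> Q (shear a (a + b) x)"
  defines "d' \<equiv> d(a - 1 := d (a - 1) + (\<Sum>i=a..<a + b. d i))"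
  shows "(\<integral>\<^sup>+x. weight (a + b) d x * indicator P x * H (T a b x) \<partial>lborel_n (a + b)) =
    (\<Sum>\<sigma> | \<sigma> permutes {..<a + b} \<and> Q (\<lambda>i. real (inv \<sigma> i)).
      \<integral>\<^sup>+y. weight (a + b) (d' \<circ> \<sigma>) y * indicator (Lambda (a + b)) y * H y \<partial>lborel_n (a + b))"
proof -
  define n where "n = a + b"
  note H' = H[folded n_def] and Q' = Q[folded n_def] and Qm' = Qm[folded n_def]
  let ?B = "{z. (\<forall>i<n. 0 \<le> z i) \<and> Q z}"
  let ?f = "\<lambda>z. weight n d' z * indicator ?B z * H (sort_vec n z)"
  have "(\<lambda>z. weight n d' z * indicator ?B z) \<in> borel_measurable (lborel_n n)"
    by (rule weight_nonneg_measurable[OF Qm'])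
  then have f: "?f \<in> borel_measurable (lborel_n n)"
    by (rule borel_measurable_times_ennreal[OF _ measurable_compose[OF sort_vec_measurable H']])
  have T_eq: "T a b x = sort_vec n (shear a n x)" for x by (simp add: T_eq_sort_vec n_def)
  have n_weight: "weight n d' (shear a n x) = weight n d x" for x
    using weight_shear[of a n d x] a by (simp add: d'_def n_def)
  have "indicator P x = (indicator ?B (shear a n x) :: ennreal)" for x
    using P[of x] by (auto simp: n_def split: split_indicator)
  then have "(\<integral>\<^sup>+x. weight n d x * indicator P x * H (T a b x) \<partial>lborel_n n)
      = (\<integral>\<^sup>+x. ?f (shear a n x) \<partial>lborel_n n)"
    by (simp only: T_eq n_weight)
  also have "\<dots> = (\<integral>\<^sup>+z. ?f z \<partial>lborel_n n)" by (rule nn_integral_shear[OF a f])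
  also have "\<dots> = (\<Sum>\<sigma> | \<sigma> permutes {..<n} \<and> Q (\<lambda>i. real (inv \<sigma> i)).
      \<integral>\<^sup>+y. weight n (d' \<circ> \<sigma>) y * indicator (Lambda n) y * H y \<partial>lborel_n n)"
    by (rule nn_integral_order_determined_sort_vec[OF H' Q' Qm'])
  finally show ?thesis by (simp only: n_def)
qed

section \<open>Excess along an orbit\<close>

definition excess :: "nat \<Rightarrow> nat \<Rightarrow> (nat \<Rightarrow> real) \<Rightarrow> real" where
  "excess a b x = (\<Sum>i<a + b. x i) - real b * x (a + b - 1)"

text \<open>Equivalently, \<open>x (a - 1)\<close> exceeds the reduced top coordinate
  \<open>x (a + b - 1) - x (a - 1)\<close>, which is then no longer the maximum.\<close>

definition overtaking :: "nat \<Rightarrow> nat \<Rightarrow> (nat \<Rightarrow> real) set" where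
  "overtaking a b = {x \<in> Lambda (a + b). x (a + b - 1) < 2 * x (a - 1)}"

lemma A_iff_excess: "x \<in> A a b \<longleftrightarrow> x \<in> Lambda (a + b) \<and> excess a b x \<le> 0"
  by (auto simp: A_def excess_def)

locale subtractive =
  fixes a b :: nat
  assumes a: "1 \<le> a" and b: "2 \<le> b"
begin

abbreviation "n \<equiv> a + b"
text \<open>\<open>Lambda\<close> constrains only the coordinates below \<open>n\<close>; the
  intersection adds extensionality, so that the set lies in the product space.\<close>

abbreviation "chamber \<equiv> Lambda n \<inter> space (lborel_n n)"

lemma shear_space: "shear a n x \<in> space (lborel_n n)"
  by (simp add: shear_def space_PiM)

lemma T_permutation:
  obtains \<sigma> where "\<sigma> permutes {..<n}" "T a b x = shear a n x \<circ> \<sigma>"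
  using sort_vec_permutation[OF shear_space] unfolding T_eq_sort_vec by metis

lemma shear_nonneg:
  assumes "x \<in> Lambda n" "i < n"
  shows "0 \<le> shear a n x i"
  using assms a by (auto simp: shear_def Lambda_iff)

lemma T_chamber: assumes "x \<in> Lambda n" shows "T a b x \<in> chamber"
proof -
  obtain \<sigma> where \<sigma>: "\<sigma> permutes {..<n}" "T a b x = shear a n x \<circ> \<sigma>"
    by (rule T_permutation)
  have "0 \<le> T a b x i" if "i < n" for i
    using shear_nonneg[OF assms] permutes_in_image[OF \<sigma>(1), of i] that \<sigma>(2) by simp
  then have "T a b x \<in> Lambda n"
    using sort_vec_mono[of _ _ n "shear a n x"] by (auto simp: Lambda_iff T_eq_sort_vec)
  then show ?thesis
    using comp_permutes_in_space[OF \<sigma>(1) shear_space, of x] \<sigma>(2) by simp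
qed

lemma funpow_T_chamber: "x \<in> chamber \<Longrightarrow> (T a b ^^ k) x \<in> chamber"
  by (induction k) (use T_chamber in auto)

lemma sum_T: "(\<Sum>i<n. T a b x i) = (\<Sum>i<n. x i) - real b * x (a - 1)"
proof -
  obtain \<sigma> where \<sigma>: "\<sigma> permutes {..<n}" "T a b x = shear a n x \<circ> \<sigma>"
    by (rule T_permutation)
  have "(\<Sum>i<n. T a b x i) = (\<Sum>i<n. shear a n x i)"
    using sum.permute[OF \<sigma>(1), of "shear a n x"] \<sigma>(2) by simp
  also have "\<dots> = (\<Sum>i<n. x i) - (\<Sum>i<n. if a \<le> i then x (a - 1) else 0)"
    by (simp add: shear_def sum_subtractf)
  also have "(\<Sum>i<n. if a \<le> i then x (a - 1) else 0) = (\<Sum>i\<in>{i\<in>{..<n}. a \<le> i}. x (a - 1))"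
    by (rule sum.inter_filter[symmetric]) simp
  also have "{i\<in>{..<n}. a \<le> i} = {a..<n}" by auto
  finally show ?thesis by simp
qed

lemma shear_le_T_last:
  assumes "i < n"
  shows "shear a n x i \<le> T a b x (n - 1)"
proof -
  obtain \<sigma> where \<sigma>: "\<sigma> permutes {..<n}" "T a b x = shear a n x \<circ> \<sigma>"
    by (rule T_permutation)
  have "inv \<sigma> i < n" using permutes_in_image[OF permutes_inv[OF \<sigma>(1)], of i] assms by simp
  then have "T a b x (inv \<sigma> i) \<le> T a b x (n - 1)"
    unfolding T_eq_sort_vec by (intro sort_vec_mono) auto
  then show ?thesis by (simp add: \<sigma>(2) permutes_inverses[OF \<sigma>(1)])
qed

text \<open>The sum drops by exactly \<open>b\<close> times the pivot \<open>x (a - 1)\<close>,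
  while the maximum drops by at most the pivot.\<close>

lemma excess_T_le: "excess a b (T a b x) \<le> excess a b x"
proof -
  have "x (n - 1) - x (a - 1) \<le> T a b x (n - 1)"
    using shear_le_T_last[of "n - 1" x] a b by (auto simp: shear_def split: if_splits)
  then have "real b * (x (n - 1) - x (a - 1)) \<le> real b * T a b x (n - 1)"
    by (intro mult_left_mono) auto
  then show ?thesis by (simp add: excess_def sum_T algebra_simps)
qed

text \<open>Without overtaking the reduced top coordinate remains the maximum, so the maximum drops
  by exactly the pivot and the two changes cancel.\<close>

lemma excess_T_eq:
  assumes x: "x \<in> Lambda n" and "x \<notin> overtaking a b"
  shows "excess a b (T a b x) = excess a b x"
proof -
  have G: "2 * x (a - 1) \<le> x (n - 1)" using assms by (auto simp: overtaking_def)
  obtain \<sigma> where \<sigma>: "\<sigma> permutes {..<n}" "T a b x = shear a n x \<circ> \<sigma>"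
    by (rule T_permutation)
  have mono: "x i \<le> x j" if "i \<le> j" "j < n" for i j using x that by (auto simp: Lambda_iff)
  have "\<sigma> (n - 1) < n" using permutes_in_image[OF \<sigma>(1), of "n - 1"] a by simp
  moreover have "shear a n x i \<le> x (n - 1) - x (a - 1)" if "i < n" for i
  proof (cases "a \<le> i")
    case True
    then show ?thesis using mono[of i "n - 1"] that by (simp add: shear_def)
  next
    case False
    then have "x i \<le> x (a - 1)" using b by (intro mono) auto
    with False that G show ?thesis by (simp add: shear_def)
  qed
  ultimately have "T a b x (n - 1) \<le> x (n - 1) - x (a - 1)" using \<sigma>(2) by simp
  moreover have "x (n - 1) - x (a - 1) \<le> T a b x (n - 1)"
    using shear_le_T_last[of "n - 1" x] a b by (auto simp: shear_def split: if_splits)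
  ultimately have eq: "T a b x (n - 1) = x (n - 1) - x (a - 1)" by simp
  show ?thesis unfolding excess_def sum_T eq by (simp add: algebra_simps)
qed

text \<open>Bound the first \<open>a\<close> coordinates by the pivot and the other \<open>b\<close>
  by the top one; the latter bound cancels against the subtracted term.\<close>

lemma excess_le_pivot:
  assumes "x \<in> Lambda n"
  shows "excess a b x \<le> real a * x (a - 1)"
proof -
  have mono: "x i \<le> x j" if "i \<le> j" "j < n" for i j using assms that by (auto simp: Lambda_iff)
  have "(\<Sum>i<n. x i) = (\<Sum>i<a. x i) + (\<Sum>i=a..<n. x i)"
    using sum.atLeastLessThan_concat[of 0 a n x] by (simp add: atLeast0LessThan)
  moreover have "(\<Sum>i<a. x i) \<le> real (card {..<a}) * x (a - 1)"
    using mono[of _ "a - 1"] a by (intro sum_bounded_above) auto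
  moreover have "(\<Sum>i=a..<n. x i) \<le> real (card {a..<n}) * x (n - 1)"
    using mono[of _ "n - 1"] by (intro sum_bounded_above) auto
  ultimately show ?thesis by (simp add: excess_def)
qed

text \<open>Each step removes \<open>b\<close> times the pivot from a coordinate sum that stays
  nonnegative, so the pivots form a summable series.\<close>

lemma pivot_tendsto_0:
  assumes "x \<in> chamber"
  shows "(\<lambda>k. (T a b ^^ k) x (a - 1)) \<longlonglongrightarrow> 0"
proof -
  let ?p = "\<lambda>k. (T a b ^^ k) x (a - 1)"
  let ?S = "\<lambda>k. \<Sum>i<n. (T a b ^^ k) x i"
  have nonneg: "0 \<le> (T a b ^^ k) x i" if "i < n" for k i
    using funpow_T_chamber[OF assms, of k] that by (auto simp: Lambda_iff)
  have S: "real b * (\<Sum>k<m. ?p k) = ?S 0 - ?S m" for m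
    by (induction m) (simp_all add: sum_T algebra_simps)
  have "summable ?p"
  proof (rule summableI_nonneg_bounded)
    show "0 \<le> ?p k" for k using nonneg[of "a - 1"] a by simp
    show "(\<Sum>k<m. ?p k) \<le> ?S 0 / real b" for m
    proof -
      have "0 \<le> ?S m" by (intro sum_nonneg nonneg) auto
      then show ?thesis using S[of m] b by (simp add: field_simps)
    qed
  qed
  then show ?thesis by (rule summable_LIMSEQ_zero)
qed

lemma excess_funpow_antimono: "j \<le> k \<Longrightarrow> excess a b ((T a b ^^ k) x) \<le> excess a b ((T a b ^^ j) x)"
  by (induction k rule: dec_induct) (use excess_T_le order_trans in \<open>auto\<close>)

text \<open>Away from \<open>overtaking\<close> the excess is constant, but it is squeezed to \<open>0\<close> by
  \<open>excess_le_pivot\<close>.\<close>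

lemma not_absorbed_imp_overtaking:
  assumes x: "x \<in> chamber" and pos: "\<And>k. (T a b ^^ k) x \<notin> A a b"
  shows "\<exists>k. (T a b ^^ k) x \<in> overtaking a b"
proof (rule ccontr)
  assume N: "\<not> ?thesis"
  let ?y = "\<lambda>k. (T a b ^^ k) x"
  have L: "?y k \<in> Lambda n" for k using funpow_T_chamber[OF x] by blast
  have const: "excess a b (?y k) = excess a b x" for k
    by (induction k) (use N L excess_T_eq in auto)
  have "excess a b x \<le> real a * ?y k (a - 1)" for k
    using excess_le_pivot[OF L, of k] const by simp
  moreover have "(\<lambda>k. real a * ?y k (a - 1)) \<longlonglongrightarrow> real a * 0"
    by (intro tendsto_intros pivot_tendsto_0 x)
  ultimately have "excess a b x \<le> 0" using LIMSEQ_le_const by fastforce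
  then have "x \<in> A a b" using L[of 0] by (simp add: A_iff_excess)
  with pos[of 0] show False by simp
qed

text \<open>At an overtaking time the top coordinate is below twice the pivot, so the excess is at
  least \<open>- 2 * b\<close> times the pivot, a bound that tends to \<open>0\<close>. The excess
  is nonincreasing, so a negative value could never recover to meet this bound.\<close>

lemma absorbed_and_overtaking_imp_zero:
  assumes x: "x \<in> chamber" and m: "(T a b ^^ m) x \<in> A a b"
    and inf: "\<And>K. \<exists>k\<ge>K. (T a b ^^ k) x \<in> overtaking a b"
  shows "excess a b ((T a b ^^ m) x) = 0"
proof (rule ccontr)
  let ?y = "\<lambda>k. (T a b ^^ k) x"
  assume "excess a b (?y m) \<noteq> 0"
  with m have neg: "excess a b (?y m) < 0" by (simp add: A_iff_excess)
  have "(\<lambda>k. - 2 * real b * ?y k (a - 1)) \<longlonglongrightarrow> - 2 * real b * 0"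
    by (intro tendsto_intros pivot_tendsto_0 x)
  then have "eventually (\<lambda>k. excess a b (?y m) < - 2 * real b * ?y k (a - 1)) sequentially"
    using neg by (intro order_tendstoD(1)) auto
  then obtain K where K: "\<And>k. k \<ge> K \<Longrightarrow> excess a b (?y m) < - 2 * real b * ?y k (a - 1)"
    by (auto simp: eventually_sequentially)
  \<comment> \<open>The time is taken past \<open>K\<close> for the smallness of the pivot and past
    \<open>m\<close> for monotonicity of the excess.\<close>
  obtain k where k: "k \<ge> max K m" "?y k \<in> overtaking a b" using inf by blast
  have "0 \<le> (\<Sum>i<n. ?y k i)"
    using funpow_T_chamber[OF x, of k] by (intro sum_nonneg) (auto simp: Lambda_iff)
  moreover have "real b * ?y k (n - 1) \<le> real b * (2 * ?y k (a - 1))"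
    using k(2) by (intro mult_left_mono) (auto simp: overtaking_def)
  ultimately have "- 2 * real b * ?y k (a - 1) \<le> excess a b (?y k)" by (simp add: excess_def)
  also have "\<dots> \<le> excess a b (?y m)" using k(1) by (intro excess_funpow_antimono) auto
  finally show False using K[of k] k(1) by simp
qed

end

section \<open>Simplicial coordinates\<close>

lemma nn_integral_exp_atLeast:
  fixes c r :: real
  assumes "0 < c"
  shows "(\<integral>\<^sup>+t. ennreal (exp (- (c * t))) * indicator {r..} t \<partial>lborel) = ennreal (exp (- (c * r)) / c)"
proof -
  have "((\<lambda>t. - exp (- (c * t)) / c) \<longlongrightarrow> - 0 / c) at_top"
    using assms
    by (intro tendsto_intros filterlim_compose[OF exp_at_bot] filterlim_uminus_at_bot_at_top[THEN filterlim_compose]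
        filterlim_tendsto_pos_mult_at_top[OF tendsto_const _ filterlim_ident]) auto
  then have "(\<integral>\<^sup>+t. ennreal (exp (- (c * t))) * indicator {r..} t \<partial>lborel) = ennreal (- 0 / c - (- exp (- (c * r)) / c))"
    using assms by (intro nn_integral_FTC_atLeast) (auto intro!: derivative_eq_intros)
  then show ?thesis by simp
qed

lemma nn_integral_exp_Icc:
  fixes c s :: real
  assumes "0 < c" "0 \<le> s"
  shows "(\<integral>\<^sup>+t. ennreal (exp (- (c * t))) * indicator {0..s} t \<partial>lborel) = ennreal ((1 - exp (- (c * s))) / c)"
proof -
  have "(\<integral>\<^sup>+t. ennreal (exp (- (c * t))) * indicator {0..s} t \<partial>lborel)
      = ennreal (- exp (- (c * s)) / c - (- exp (- (c * 0)) / c))"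
    using assms by (intro nn_integral_FTC_Icc) (auto intro!: derivative_eq_intros)
  then show ?thesis by (simp add: diff_divide_distrib)
qed

text \<open>Linear coordinates in which \<open>Lambda\<close> becomes the nonnegative orthant; the
  first gap is measured from \<open>0\<close>.\<close>

definition gaps :: "nat \<Rightarrow> (nat \<Rightarrow> real) \<Rightarrow> nat \<Rightarrow> real" where
  "gaps n x = (\<lambda>i\<in>{..<n}. x i - (if i = 0 then 0 else x (i - 1)))"

lemma sum_gaps: "j < n \<Longrightarrow> (\<Sum>i\<le>j. gaps n x i) = x j"
proof (induction j)
  case (Suc j)
  then have "(\<Sum>i\<le>j. gaps n x i) = x j" by simp
  moreover have "gaps n x (Suc j) = x (Suc j) - x j" using Suc.prems by (simp add: gaps_def)
  ultimately show ?case by simp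
qed (simp add: gaps_def)

text \<open>Summation by parts: gap \<open>j\<close> enters every coordinate from \<open>j\<close>
  on, so its coefficient is a tail sum of \<open>d\<close>.\<close>

lemma sum_mult_eq_sum_gaps:
  "(\<Sum>i<n. d i * x i) = (\<Sum>j<n. (\<Sum>i=j..<n. d i) * gaps n x j)"
proof -
  have swap: "(\<Sum>i<m. d i * (\<Sum>j\<le>i. t j)) = (\<Sum>j<m. (\<Sum>i=j..<m. d i) * t j)" for m and t :: "nat \<Rightarrow> real"
  proof (induction m)
    case (Suc m)
    have "(\<Sum>j<Suc m. (\<Sum>i=j..<Suc m. d i) * t j) = (\<Sum>j<m. (\<Sum>i=j..<m. d i) * t j + d m * t j) + d m * t m"
      by (simp add: algebra_simps)
    also have "\<dots> = (\<Sum>j<m. (\<Sum>i=j..<m. d i) * t j) + d m * (\<Sum>j\<le>m. t j)"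
      by (simp add: sum.distrib sum_distrib_left lessThan_Suc_atMost[symmetric] distrib_left)
    finally show ?case using Suc by simp
  qed simp
  have "(\<Sum>i<n. d i * x i) = (\<Sum>i<n. d i * (\<Sum>j\<le>i. gaps n x j))"
    by (intro sum.cong) (auto simp: sum_gaps)
  then show ?thesis by (simp add: swap)
qed

lemma Lambda_iff_gaps: "x \<in> Lambda n \<longleftrightarrow> (\<forall>i<n. 0 \<le> gaps n x i)"
proof
  assume x: "x \<in> Lambda n"
  show "\<forall>i<n. 0 \<le> gaps n x i"
  proof (intro allI impI)
    fix i assume "i < n"
    moreover then have "x (i - 1) \<le> x i" using x by (auto simp: Lambda_iff)
    ultimately show "0 \<le> gaps n x i" using x by (auto simp: gaps_def Lambda_iff)
  qed
next
  assume g: "\<forall>i<n. 0 \<le> gaps n x i"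
  have "0 \<le> x i" if "i < n" for i
    using g that sum_nonneg[of "{..i}" "gaps n x"] by (simp add: sum_gaps)
  moreover have "x i \<le> x (i + 1)" if "i + 1 < n" for i
    using g[rule_format, OF that] that by (simp add: gaps_def)
  ultimately show "x \<in> Lambda n" by (auto simp: Lambda_def)
qed

text \<open>Passing to gaps is a triangular shift and preserves the measure; the product integrand
  then splits by Tonelli.\<close>

lemma nn_integral_prod_gaps:
  fixes f :: "nat \<Rightarrow> real \<Rightarrow> ennreal"
  assumes "\<And>i. i < n \<Longrightarrow> f i \<in> borel_measurable borel"
  shows "(\<integral>\<^sup>+x. (\<Prod>i<n. f i (gaps n x i)) \<partial>lborel_n n) = (\<Prod>i<n. \<integral>\<^sup>+t. f i t \<partial>lborel)"
proof -
  let ?g = "\<lambda>i x. if i = 0 then 0 else - x (i - 1) :: real"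
  let ?f = "\<lambda>x. \<Prod>i<n. f i (x i)"
  have "gaps n x = (\<lambda>i\<in>{..<n}. x i + ?g i (restrict x {..<i}))" for x
    by (auto simp: gaps_def fun_eq_iff)
  moreover have "?g i \<in> borel_measurable (lborel_n i)" for i
    by (cases "i = 0") (auto intro!: borel_measurable_uminus borel_measurable_lborel_n_component)
  moreover have "?f \<in> borel_measurable (lborel_n n)"
    by (intro borel_measurable_prod_ennreal measurable_compose[OF borel_measurable_lborel_n_component assms]) auto
  ultimately have "(\<integral>\<^sup>+x. ?f (gaps n x) \<partial>lborel_n n) = (\<integral>\<^sup>+x. ?f x \<partial>lborel_n n)"
    using nn_integral_triangular_shift[of n ?g ?f] by simp
  also have "\<dots> = (\<Prod>i<n. \<integral>\<^sup>+t. f i t \<partial>lborel)"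
    using assms by (intro lborel_prod.product_nn_integral_prod) auto
  finally show ?thesis .
qed

lemma weight_indicator_gaps:
  "weight n d x * indicator {x. \<forall>j<n. gaps n x j \<in> B j} x =
    (\<Prod>j<n. ennreal (exp (- ((\<Sum>i=j..<n. d i) * gaps n x j))) * indicator (B j) (gaps n x j))"
proof -
  have "weight n d x = (\<Prod>j<n. ennreal (exp (- ((\<Sum>i=j..<n. d i) * gaps n x j))))"
    by (subst weight_def, subst sum_mult_eq_sum_gaps, subst sum_negf[symmetric],
        subst exp_sum[OF finite_lessThan], rule prod_ennreal[symmetric]) simp
  moreover have "(\<Prod>j<m. indicator (B j) (gaps n x j)) = (indicator {x. \<forall>j<m. gaps n x j \<in> B j} x :: ennreal)" for m
    by (induction m) (auto simp: less_Suc_eq split: split_indicator)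
  ultimately show ?thesis by (simp add: prod.distrib)
qed

text \<open>In gap coordinates this is a product of exponential integrals over half-lines, whose
  rates are the positive tail sums of \<open>d\<close>.\<close>

lemma nn_integral_weight_Lambda:
  assumes d: "\<And>i. i < n \<Longrightarrow> 0 < d i"
  shows "(\<integral>\<^sup>+x. weight n d x * indicator (Lambda n) x \<partial>lborel_n n) = (\<Prod>j<n. ennreal (1 / (\<Sum>i=j..<n. d i)))"
proof -
  define c where "c j = (\<Sum>i=j..<n. d i)" for j
  have c: "0 < c j" if "j < n" for j
    unfolding c_def using that d by (intro sum_pos) auto
  have Lam: "Lambda n = {x. \<forall>j<n. gaps n x j \<in> {0..}}" by (auto simp: Lambda_iff_gaps)
  have "(\<integral>\<^sup>+x. weight n d x * indicator (Lambda n) x \<partial>lborel_n n)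
      = (\<Prod>j<n. \<integral>\<^sup>+t. ennreal (exp (- (c j * t))) * indicator {0..} t \<partial>lborel)"
    unfolding Lam weight_indicator_gaps c_def[symmetric] by (intro nn_integral_prod_gaps) auto
  also have "\<dots> = (\<Prod>j<n. ennreal (1 / c j))"
    using c by (intro prod.cong) (auto simp: nn_integral_exp_atLeast)
  finally show ?thesis by (simp only: c_def)
qed

section \<open>A uniform lower bound for the share of \<open>A\<close>\<close>

context subtractive
begin

text \<open>After rescaling gap \<open>j\<close> by \<open>c j\<close>, the box forces the first \<open>a\<close> gaps to be small against the last
  one. For decreasing \<open>c\<close> this survives undoing the rescaling, and the mass of the box does not
  depend on \<open>c\<close>.\<close>

definition gap_box :: "(nat \<Rightarrow> real) \<Rightarrow> nat \<Rightarrow> real set" where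
  "gap_box c j = (if j < a then {0..1 / (real a ^ 2 * c j)} else if j = n - 1 then {1 / c j..} else {0..})"

text \<open>The probability of \<open>gap_box c j\<close> under the exponential law of rate
  \<open>c j\<close>, which is the same for every positive rate.\<close>

definition box_mass :: "nat \<Rightarrow> real" where
  "box_mass j = (if j < a then 1 - exp (- (1 / real a ^ 2)) else if j = n - 1 then exp (- 1) else 1)"

definition absorbing_fraction :: real where
  "absorbing_fraction = (\<Prod>j<n. box_mass j)"

lemma box_mass_pos: "0 < box_mass j"
  using a by (simp add: box_mass_def)

lemma absorbing_fraction_pos: "0 < absorbing_fraction"
  unfolding absorbing_fraction_def by (intro prod_pos box_mass_pos)

text \<open>The first \<open>a\<close> gaps add up to \<open>x (a - 1)\<close>, so the box gives
  \<open>a * x (a - 1) \<le> x (n - 1) - x (n - 2)\<close>. In the total sum the first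
  \<open>a\<close> coordinates thus cost at most the last gap, which together with the remaining
  ones stays below \<open>b\<close> times the top coordinate.\<close>

lemma box_subset_A:
  assumes c: "\<And>j. j < n \<Longrightarrow> 0 < c j" and dec: "\<And>j. j < n \<Longrightarrow> c (n - 1) \<le> c j"
    and x: "\<And>j. j < n \<Longrightarrow> gaps n x j \<in> gap_box c j"
  shows "x \<in> A a b"
proof -
  have "0 \<le> gaps n x j" if "j < n" for j
    using x[OF that] c[OF that] order_trans[of 0 "1 / c j" "gaps n x j"]
    by (auto simp: gap_box_def split: if_splits)
  then have L: "x \<in> Lambda n" by (simp add: Lambda_iff_gaps)
  have mono: "x i \<le> x j" if "i \<le> j" "j < n" for i j using L that by (auto simp: Lambda_iff)
  have c': "0 < c (n - 1)" using c a by simp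
  have "gaps n x j \<le> 1 / (real a ^ 2 * c (n - 1))" if "j < a" for j
  proof -
    have "gaps n x j \<le> 1 / (real a ^ 2 * c j)" using x[of j] that by (simp add: gap_box_def)
    also have "\<dots> \<le> 1 / (real a ^ 2 * c (n - 1))"
      using a c' dec[of j] that by (intro divide_left_mono mult_left_mono mult_pos_pos) auto
    finally show ?thesis .
  qed
  then have "(\<Sum>j\<le>a - 1. gaps n x j) \<le> real (card {..a - 1}) * (1 / (real a ^ 2 * c (n - 1)))"
    using a by (intro sum_bounded_above) auto
  also have "(\<Sum>j\<le>a - 1. gaps n x j) = x (a - 1)" using a by (intro sum_gaps) auto
  also have "card {..a - 1} = a" using a by simp
  \<comment> \<open>The square of \<open>a\<close> in the box is consumed here: one factor counts
    the gaps below \<open>x (a - 1)\<close>, the other the coordinates bounded by it.\<close>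
  finally have "real a * x (a - 1) \<le> real a * (real a * (1 / (real a ^ 2 * c (n - 1))))"
    by (intro mult_left_mono) auto
  also have "\<dots> = 1 / c (n - 1)" using a by (simp add: power2_eq_square)
  also have "\<dots> \<le> gaps n x (n - 1)" using x[of "n - 1"] a b by (auto simp: gap_box_def split: if_splits)
  also have "\<dots> = x (n - 1) - x (n - 2)"
    using a b by (simp add: gaps_def numeral_2_eq_2)
  finally have pivot: "real a * x (a - 1) \<le> x (n - 1) - x (n - 2)" .
  have "(\<Sum>i<n. x i) = (\<Sum>i<a. x i) + (\<Sum>i=a..<n. x i)"
    using sum.atLeastLessThan_concat[of 0 a n x] by (simp add: atLeast0LessThan)
  also have "(\<Sum>i=a..<n. x i) = (\<Sum>i=a..<n - 1. x i) + x (n - 1)"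
    using sum.atLeastLessThan_Suc[of a "n - 1" x] b by simp
  also have "(\<Sum>i<a. x i) \<le> real (card {..<a}) * x (a - 1)"
    using mono[of _ "a - 1"] a by (intro sum_bounded_above) auto
  also have "(\<Sum>i=a..<n - 1. x i) \<le> real (card {a..<n - 1}) * x (n - 2)"
    using mono[of _ "n - 2"] by (intro sum_bounded_above) auto
  finally have "(\<Sum>i<n. x i) \<le> real a * x (a - 1) + (real (b - 1) * x (n - 2) + x (n - 1))"
    by simp
  also have "\<dots> \<le> (x (n - 1) - x (n - 2)) + (real (b - 1) * x (n - 2) + x (n - 1))"
    using pivot by simp
  \<comment> \<open>The hypothesis \<open>b \<ge> 2\<close> makes the coefficient
    \<open>b - 2\<close> a genuine difference.\<close>
  also have "\<dots> = 2 * x (n - 1) + real (b - 2) * x (n - 2)"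
    using b by (simp add: of_nat_diff algebra_simps)
  also have "\<dots> \<le> 2 * x (n - 1) + real (b - 2) * x (n - 1)"
    using mono[of "n - 2" "n - 1"] a by (intro add_left_mono mult_left_mono) auto
  also have "\<dots> = real b * x (n - 1)" using b by (simp add: of_nat_diff algebra_simps)
  finally show ?thesis using L by (simp add: A_def)
qed

lemma absorbing_fraction_le:
  assumes d: "\<And>i. i < n \<Longrightarrow> 0 < d i"
  shows "ennreal absorbing_fraction * (\<integral>\<^sup>+x. weight n d x * indicator (Lambda n) x \<partial>lborel_n n)
    \<le> (\<integral>\<^sup>+x. weight n d x * indicator (A a b) x \<partial>lborel_n n)"
proof -
  define c where "c j = (\<Sum>i=j..<n. d i)" for j
  have c: "0 < c j" if "j < n" for j
    unfolding c_def using that d by (intro sum_pos) auto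
  \<comment> \<open>Tail sums of positive numbers; beyond positivity this comparison is all that the
    box argument needs of \<open>c\<close>.\<close>
  have dec: "c (n - 1) \<le> c j" if "j < n" for j
    unfolding c_def using that d by (intro sum_mono2) (auto intro: less_imp_le)
  have total: "(\<integral>\<^sup>+x. weight n d x * indicator (Lambda n) x \<partial>lborel_n n) = (\<Prod>j<n. ennreal (1 / c j))"
    using nn_integral_weight_Lambda[of n d] d by (simp add: c_def)
  have "ennreal absorbing_fraction * (\<Prod>j<n. ennreal (1 / c j)) = (\<Prod>j<n. ennreal (box_mass j) * ennreal (1 / c j))"
    by (simp add: absorbing_fraction_def prod_ennreal[symmetric] less_imp_le[OF box_mass_pos] prod.distrib)
  also have "\<dots> = (\<Prod>j<n. ennreal (box_mass j / c j))"
    using c by (intro prod.cong refl) (simp add: ennreal_mult[symmetric] less_imp_le box_mass_pos)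
  also have "\<dots> = (\<Prod>j<n. \<integral>\<^sup>+t. ennreal (exp (- (c j * t))) * indicator (gap_box c j) t \<partial>lborel)"
  proof (intro prod.cong refl)
    fix j assume "j \<in> {..<n}"
    then show "ennreal (box_mass j / c j) = (\<integral>\<^sup>+t. ennreal (exp (- (c j * t))) * indicator (gap_box c j) t \<partial>lborel)"
      using c[of j] by (auto simp: gap_box_def box_mass_def nn_integral_exp_atLeast nn_integral_exp_Icc)
  qed
  also have "\<dots> = (\<integral>\<^sup>+x. weight n d x * indicator {x. \<forall>j<n. gaps n x j \<in> gap_box c j} x \<partial>lborel_n n)"
    unfolding weight_indicator_gaps c_def[symmetric]
    by (intro nn_integral_prod_gaps[symmetric]) (auto simp: gap_box_def)
  also have "\<dots> \<le> (\<integral>\<^sup>+x. weight n d x * indicator (A a b) x \<partial>lborel_n n)"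
    using box_subset_A[of c]  c dec by (intro nn_integral_mono mult_left_mono) (auto split: split_indicator)
  finally show ?thesis unfolding total .
qed

end

section \<open>Uniformly absorbed sets\<close>

context subtractive
begin

definition weighted :: "(nat \<Rightarrow> real) \<Rightarrow> (nat \<Rightarrow> real) measure" where
  "weighted d = density (lborel_n n) (weight n d)"

lemma sets_weighted [simp]: "sets (weighted d) = sets (lborel_n n)"
  by (simp add: weighted_def)

lemma emeasure_weighted:
  "E \<in> sets (lborel_n n) \<Longrightarrow> emeasure (weighted d) E = (\<integral>\<^sup>+x. weight n d x * indicator E x \<partial>lborel_n n)"
  unfolding weighted_def by (rule emeasure_density[OF weight_measurable])

lemma chamber_sets: "chamber \<in> sets (lborel_n n)"
  using Lambda_sets[of n] by (simp add: Int_def conj_commute)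

lemma excess_measurable: "excess a b \<in> borel_measurable (lborel_n n)"
  unfolding excess_def
  using a by (intro borel_measurable_diff borel_measurable_sum borel_measurable_times
      borel_measurable_const borel_measurable_lborel_n_component) auto

lemma A_chamber_sets: "A a b \<inter> space (lborel_n n) \<in> sets (lborel_n n)"
proof -
  have "{x \<in> space (lborel_n n). x \<in> Lambda n \<and> excess a b x \<le> 0} \<in> sets (lborel_n n)"
    by (intro sets.sets_Collect_conj borel_measurable_le Lambda_sets excess_measurable borel_measurable_const)
  moreover have "{x \<in> space (lborel_n n). x \<in> Lambda n \<and> excess a b x \<le> 0} = A a b \<inter> space (lborel_n n)"
    by (auto simp: A_iff_excess)
  ultimately show ?thesis by (simp only:)
qed

lemma overtaking_chamber_sets: "overtaking a b \<inter> space (lborel_n n) \<in> sets (lborel_n n)"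
proof -
  have "{x \<in> space (lborel_n n). x \<in> Lambda n \<and> x (n - 1) < 2 * x (a - 1)} \<in> sets (lborel_n n)"
    using a b by (intro sets.sets_Collect_conj borel_measurable_less Lambda_sets borel_measurable_times
        borel_measurable_const borel_measurable_lborel_n_component) auto
  moreover have "{x \<in> space (lborel_n n). x \<in> Lambda n \<and> x (n - 1) < 2 * x (a - 1)}
      = overtaking a b \<inter> space (lborel_n n)"
    by (auto simp: overtaking_def)
  ultimately show ?thesis by (simp only:)
qed

lemma funpow_T_sets:
  assumes "E \<inter> space (lborel_n n) \<in> sets (lborel_n n)"
  shows "{x \<in> chamber. (T a b ^^ k) x \<in> E} \<in> sets (lborel_n n)"
proof -
  have T: "T a b ^^ k \<in> measurable (lborel_n n) (lborel_n n)"
    by (intro measurable_compose_n T_measurable a)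
  have "{x \<in> chamber. (T a b ^^ k) x \<in> E} =
      chamber \<inter> ((T a b ^^ k) -` (E \<inter> space (lborel_n n)) \<inter> space (lborel_n n))"
    using measurable_space[OF T] by auto
  then show ?thesis using measurable_sets[OF T assms] chamber_sets by (simp only: sets.Int)
qed

definition absorbed :: "(nat \<Rightarrow> real) set" where
  "absorbed = {x \<in> chamber. \<exists>k. (T a b ^^ k) x \<in> A a b}"

lemma absorbed_sets: "absorbed \<in> sets (lborel_n n)"
proof -
  have "absorbed = (\<Union>k. {x \<in> chamber. (T a b ^^ k) x \<in> A a b})" by (auto simp: absorbed_def)
  then show ?thesis using funpow_T_sets[OF A_chamber_sets] by auto
qed

lemma absorbed_if_T_absorbed:
  assumes "x \<in> chamber" "T a b x \<in> absorbed"
  shows "x \<in> absorbed"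
proof -
  obtain k where "(T a b ^^ Suc k) x \<in> A a b"
    using assms(2) by (auto simp: absorbed_def funpow_Suc_right simp del: funpow.simps)
  with assms(1) show ?thesis unfolding absorbed_def by blast
qed

text \<open>The bound is required for all positive \<open>d\<close> with one constant. Since pulling
  back along \<open>T\<close> changes only \<open>d\<close>, this uniformity makes the property
  stable under inverse images.\<close>

definition fraction_absorbed :: "(nat \<Rightarrow> real) set \<Rightarrow> bool" where
  "fraction_absorbed F \<longleftrightarrow> F \<in> sets (lborel_n n) \<and> F \<subseteq> chamber \<and> (\<forall>d. (\<forall>i<n. 0 < d i) \<longrightarrow>
    ennreal absorbing_fraction * emeasure (weighted d) F \<le> emeasure (weighted d) (F \<inter> absorbed))"

text \<open>The points already in \<open>A\<close>, absorbed at time \<open>0\<close>, make up the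
  required fraction.\<close>

lemma fraction_absorbed_chamber: "fraction_absorbed chamber"
proof -
  have "ennreal absorbing_fraction * emeasure (weighted d) chamber \<le> emeasure (weighted d) (chamber \<inter> absorbed)"
    if d: "\<forall>i<n. 0 < d i" for d
  proof -
    have "emeasure (weighted d) chamber = (\<integral>\<^sup>+x. weight n d x * indicator (Lambda n) x \<partial>lborel_n n)"
      unfolding emeasure_weighted[OF chamber_sets] by (intro nn_integral_cong) (auto split: split_indicator)
    then have "ennreal absorbing_fraction * emeasure (weighted d) chamber
        \<le> (\<integral>\<^sup>+x. weight n d x * indicator (A a b) x \<partial>lborel_n n)"
      using absorbing_fraction_le[of d] d by simp
    also have "\<dots> = emeasure (weighted d) (A a b \<inter> space (lborel_n n))"
      unfolding emeasure_weighted[OF A_chamber_sets] by (intro nn_integral_cong) (auto split: split_indicator)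
    also have "A a b \<inter> space (lborel_n n) \<subseteq> chamber \<inter> absorbed"
    proof
      fix x assume x: "x \<in> A a b \<inter> space (lborel_n n)"
      then have "(T a b ^^ 0) x \<in> A a b" "x \<in> chamber" by (auto simp: A_def)
      then show "x \<in> chamber \<inter> absorbed" unfolding absorbed_def by blast
    qed
    then have "emeasure (weighted d) (A a b \<inter> space (lborel_n n)) \<le> emeasure (weighted d) (chamber \<inter> absorbed)"
      using chamber_sets absorbed_sets by (intro emeasure_mono) auto
    finally show ?thesis .
  qed
  then show ?thesis using chamber_sets by (auto simp: fraction_absorbed_def)
qed

text \<open>The image of the chamber under \<open>shear\<close> is cut out by nonnegativity and this order condition,
  so the inverse image of a set under \<open>T\<close> meets every branch in a full linear copy of it.\<close>

definition merging :: "(nat \<Rightarrow> real) \<Rightarrow> bool" where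
  "merging z \<longleftrightarrow> (\<forall>j\<in>{..<n}. \<forall>i\<in>{..j}. (j < a \<or> a \<le> i) \<longrightarrow> z i \<le> z j)"

text \<open>Order within the blocks below \<open>a\<close> and from \<open>a\<close> on is
  \<open>merging\<close>. Order across the cut needs only \<open>x (a - 1) \<le> x i\<close> for
  \<open>i \<ge> a\<close>, which is nonnegativity of the sheared coordinate.\<close>

lemma Lambda_iff_shear:
  "x \<in> Lambda n \<longleftrightarrow> (\<forall>i<n. 0 \<le> shear a n x i) \<and> merging (shear a n x)"
proof
  assume x: "x \<in> Lambda n"
  then show "(\<forall>i<n. 0 \<le> shear a n x i) \<and> merging (shear a n x)"
    using shear_nonneg[OF x] by (auto simp: merging_def Lambda_iff shear_def)
next
  assume R: "(\<forall>i<n. 0 \<le> shear a n x i) \<and> merging (shear a n x)"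
  have small: "0 \<le> x i" if "i < a" for i
    using conjunct1[OF R, rule_format, of i] that by (simp add: shear_def)
  have large: "x (a - 1) \<le> x i" if "a \<le> i" "i < n" for i
    using conjunct1[OF R, rule_format, of i] that by (simp add: shear_def)
  have merge: "shear a n x i \<le> shear a n x j" if "i \<le> j" "j < n" "j < a \<or> a \<le> i" for i j
    using R that by (auto simp: merging_def)
  have "x i \<le> x j" if "i \<le> j" "j < n" for i j
  proof (cases "j < a \<or> a \<le> i")
    case True
    then show ?thesis using merge[OF that True] that by (auto simp: shear_def split: if_splits)
  next
    case False
    then have "shear a n x i \<le> shear a n x (a - 1)" using a by (intro merge) auto
    with False have "x i \<le> x (a - 1)" using a by (simp add: shear_def split: if_splits)
    also have "\<dots> \<le> x j" using False that by (intro large) auto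
    finally show ?thesis .
  qed
  moreover have "0 \<le> x i" if "i < n" for i
    using small[of i] small[of "a - 1"] large[of i] that a by (cases "i < a") auto
  ultimately show "x \<in> Lambda n" by (simp add: Lambda_iff)
qed

lemma overtaking_iff_shear:
  "x \<in> overtaking a b \<longleftrightarrow> (\<forall>i<n. 0 \<le> shear a n x i) \<and>
    (merging (shear a n x) \<and> shear a n x (n - 1) < shear a n x (a - 1))"
proof -
  have "shear a n x (n - 1) < shear a n x (a - 1) \<longleftrightarrow> x (n - 1) < 2 * x (a - 1)"
    using a b by (auto simp: shear_def)
  then show ?thesis by (auto simp: overtaking_def Lambda_iff_shear)
qed

lemma order_determined_merging: "order_determined n merging"
  by (auto simp: order_determined_def merging_def)

lemma order_determined_less:
  assumes "i < n" "j < n"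
  shows "order_determined n (\<lambda>z. z i < z j)"
  using assms by (auto simp: order_determined_def not_le[symmetric])

lemma order_determined_conj:
  "order_determined n P \<Longrightarrow> order_determined n Q \<Longrightarrow> order_determined n (\<lambda>z. P z \<and> Q z)"
  unfolding order_determined_def by metis

lemma order_determined_not: "order_determined n P \<Longrightarrow> order_determined n (\<lambda>z. \<not> P z)"
  unfolding order_determined_def by metis

lemma merging_sets: "{z \<in> space (lborel_n n). merging z} \<in> sets (lborel_n n)"
  unfolding merging_def
  by (intro sets.sets_Collect_finite_All sets.sets_Collect_imp sets.sets_Collect_const
      borel_measurable_le borel_measurable_lborel_n_component) auto

section \<open>Pulling weighted measures back along the map\<close>

lemma T_vimage_sets:
  assumes "P \<inter> space (lborel_n n) \<in> sets (lborel_n n)" "E \<in> sets (lborel_n n)"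
  shows "{x \<in> P \<inter> space (lborel_n n). T a b x \<in> E} \<in> sets (lborel_n n)"
proof -
  have "{x \<in> P \<inter> space (lborel_n n). T a b x \<in> E} =
      (P \<inter> space (lborel_n n)) \<inter> (T a b -` E \<inter> space (lborel_n n))" by auto
  then show ?thesis using assms measurable_sets[OF T_measurable[OF a] assms(2)] by (simp only: sets.Int)
qed

definition pullback_weights :: "(nat \<Rightarrow> real) \<Rightarrow> nat \<Rightarrow> real" where
  "pullback_weights d = d(a - 1 := d (a - 1) + (\<Sum>i=a..<n. d i))"

lemma pullback_weights_pos:
  assumes "\<forall>i<n. 0 < d i" "i < n"
  shows "0 < pullback_weights d i"
proof -
  have "0 \<le> (\<Sum>i=a..<n. d i)" using assms by (intro sum_nonneg) (auto intro: less_imp_le)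
  moreover have "0 < d (a - 1)" using assms a b by auto
  ultimately have "0 < d (a - 1) + (\<Sum>i=a..<n. d i)" by simp
  then show ?thesis using assms by (simp add: pullback_weights_def)
qed

text \<open>Regions \<open>P\<close> of \<open>Lambda\<close> that are, up to null sets, unions of
  full branches of \<open>T\<close>; the predicate \<open>Q\<close> tells which branches.\<close>

definition order_region :: "((nat \<Rightarrow> real) \<Rightarrow> bool) \<Rightarrow> (nat \<Rightarrow> real) set \<Rightarrow> bool" where
  "order_region Q P \<longleftrightarrow> order_determined n Q \<and> {z \<in> space (lborel_n n). Q z} \<in> sets (lborel_n n) \<and>
    P \<inter> space (lborel_n n) \<in> sets (lborel_n n) \<and> P \<subseteq> Lambda n \<and>
    (\<forall>x. x \<in> P \<longleftrightarrow> (\<forall>i<n. 0 \<le> shear a n x i) \<and> Q (shear a n x))"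

text \<open>The branch formula with the indicator of \<open>E\<close> as test function: the mass of
  an inverse image is a finite sum of masses of \<open>E\<close> itself under other weights.\<close>

lemma emeasure_weighted_T_vimage:
  assumes P: "order_region Q P" and E: "E \<in> sets (lborel_n n)" "E \<subseteq> chamber"
  shows "emeasure (weighted d) {x \<in> P \<inter> space (lborel_n n). T a b x \<in> E} =
    (\<Sum>\<sigma> | \<sigma> permutes {..<n} \<and> Q (\<lambda>i. real (inv \<sigma> i)). emeasure (weighted (pullback_weights d \<circ> \<sigma>)) E)"
proof -
  let ?F = "{x \<in> P \<inter> space (lborel_n n). T a b x \<in> E}"
  have F: "?F \<in> sets (lborel_n n)"
    using P E(1) by (intro T_vimage_sets) (auto simp: order_region_def)
  have "emeasure (weighted d) ?F = (\<integral>\<^sup>+x. weight n d x * indicator ?F x \<partial>lborel_n n)"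
    by (rule emeasure_weighted[OF F])
  also have "\<dots> = (\<integral>\<^sup>+x. weight n d x * indicator P x * indicator E (T a b x) \<partial>lborel_n n)"
    by (intro nn_integral_cong) (auto split: split_indicator)
  also have "\<dots> = (\<Sum>\<sigma> | \<sigma> permutes {..<n} \<and> Q (\<lambda>i. real (inv \<sigma> i)).
      \<integral>\<^sup>+y. weight n (pullback_weights d \<circ> \<sigma>) y * indicator (Lambda n) y * indicator E y \<partial>lborel_n n)"
    unfolding pullback_weights_def
    using P by (intro nn_integral_branches a borel_measurable_indicator E) (auto simp: order_region_def)
  also have "\<dots> = (\<Sum>\<sigma> | \<sigma> permutes {..<n} \<and> Q (\<lambda>i. real (inv \<sigma> i)). emeasure (weighted (pullback_weights d \<circ> \<sigma>)) E)"
    unfolding emeasure_weighted[OF E(1)]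
    using E(2) by (intro sum.cong refl nn_integral_cong) (auto split: split_indicator)
  finally show ?thesis .
qed

text \<open>Apply the branch formula to \<open>F\<close> and to \<open>F \<inter> absorbed\<close>.
  The inequality for \<open>F\<close> holds termwise because all pulled-back weights are positive,
  and a point of the chamber with absorbed image is absorbed.\<close>

lemma fraction_absorbed_T_vimage:
  assumes P: "order_region Q P" and F: "fraction_absorbed F"
  shows "fraction_absorbed {x \<in> P \<inter> space (lborel_n n). T a b x \<in> F}"
proof -
  let ?V = "\<lambda>E. {x \<in> P \<inter> space (lborel_n n). T a b x \<in> E}"
  let ?S = "{\<sigma>. \<sigma> permutes {..<n} \<and> Q (\<lambda>i. real (inv \<sigma> i))}"
  have Fs: "F \<in> sets (lborel_n n)" "F \<subseteq> chamber" using F by (auto simp: fraction_absorbed_def)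
  have V: "?V E \<in> sets (lborel_n n)" if "E \<in> sets (lborel_n n)" for E
    using P that by (intro T_vimage_sets) (auto simp: order_region_def)
  have "ennreal absorbing_fraction * emeasure (weighted d) (?V F) \<le> emeasure (weighted d) (?V F \<inter> absorbed)"
    if d: "\<forall>i<n. 0 < d i" for d
  proof -
    have "ennreal absorbing_fraction * emeasure (weighted d) (?V F)
        = (\<Sum>\<sigma>\<in>?S. ennreal absorbing_fraction * emeasure (weighted (pullback_weights d \<circ> \<sigma>)) F)"
      by (simp only: emeasure_weighted_T_vimage[OF P Fs] sum_distrib_left)
    also have "\<dots> \<le> (\<Sum>\<sigma>\<in>?S. emeasure (weighted (pullback_weights d \<circ> \<sigma>)) (F \<inter> absorbed))"
    proof (intro sum_mono)
      fix \<sigma> assume "\<sigma> \<in> ?S"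
      then have \<sigma>: "\<sigma> permutes {..<n}" by simp
      have "0 < (pullback_weights d \<circ> \<sigma>) i" if "i < n" for i
        using pullback_weights_pos[OF d] permutes_in_image[OF \<sigma>, of i] that by simp
      then show "ennreal absorbing_fraction * emeasure (weighted (pullback_weights d \<circ> \<sigma>)) F
          \<le> emeasure (weighted (pullback_weights d \<circ> \<sigma>)) (F \<inter> absorbed)"
        using F unfolding fraction_absorbed_def by blast
    qed
    also have "\<dots> = emeasure (weighted d) (?V (F \<inter> absorbed))"
      using Fs absorbed_sets by (intro emeasure_weighted_T_vimage[OF P, symmetric]) auto
    also have "\<dots> \<le> emeasure (weighted d) (?V F \<inter> absorbed)"
    proof (rule emeasure_mono)
      show "?V (F \<inter> absorbed) \<subseteq> ?V F \<inter> absorbed"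
        using P absorbed_if_T_absorbed by (auto simp: order_region_def)
      show "?V F \<inter> absorbed \<in> sets (weighted d)" using V[OF Fs(1)] absorbed_sets by auto
    qed
    finally show ?thesis .
  qed
  moreover have "?V F \<subseteq> chamber" using P by (auto simp: order_region_def)
  ultimately show ?thesis using V[OF Fs(1)] by (simp only: fraction_absorbed_def) blast
qed

lemma order_region_Lambda: "order_region merging (Lambda n)"
  using order_determined_merging merging_sets chamber_sets Lambda_iff_shear by (simp add: order_region_def)

lemma less_sets: "{z \<in> space (lborel_n n). z (n - 1) < z (a - 1)} \<in> sets (lborel_n n)"
  using a b by (intro borel_measurable_less borel_measurable_lborel_n_component) auto

lemma order_region_overtaking:
  "order_region (\<lambda>z. merging z \<and> z (n - 1) < z (a - 1)) (overtaking a b)"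
  unfolding order_region_def
proof (intro conjI order_determined_conj order_determined_merging order_determined_less
    sets.sets_Collect_conj merging_sets less_sets overtaking_chamber_sets)
  show "\<forall>x. (x \<in> overtaking a b) = ((\<forall>i<n. 0 \<le> shear a n x i) \<and> merging (shear a n x) \<and>
      shear a n x (n - 1) < shear a n x (a - 1))"
    using overtaking_iff_shear by blast
qed (use a b in \<open>auto simp: overtaking_def\<close>)

lemma order_region_not_overtaking:
  "order_region (\<lambda>z. merging z \<and> \<not> z (n - 1) < z (a - 1)) (Lambda n - overtaking a b)"
  unfolding order_region_def
proof (intro conjI order_determined_conj order_determined_merging order_determined_not order_determined_less
    sets.sets_Collect_conj sets.sets_Collect_neg merging_sets less_sets)
  show "(Lambda n - overtaking a b) \<inter> space (lborel_n n) \<in> sets (lborel_n n)"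
    using sets.Diff[OF chamber_sets overtaking_chamber_sets] by (simp add: Diff_Int_distrib2)
  show "\<forall>x. (x \<in> Lambda n - overtaking a b) = ((\<forall>i<n. 0 \<le> shear a n x i) \<and> merging (shear a n x) \<and>
      \<not> shear a n x (n - 1) < shear a n x (a - 1))"
    using overtaking_iff_shear Lambda_iff_shear by blast
qed (use a b in auto)

lemma fraction_absorbed_UN:
  fixes F :: "nat \<Rightarrow> (nat \<Rightarrow> real) set"
  assumes F: "\<And>k. fraction_absorbed (F k)" and disj: "disjoint_family F"
  shows "fraction_absorbed (\<Union>k. F k)"
proof -
  have Fs: "F k \<in> sets (lborel_n n)" "F k \<subseteq> chamber" for k using F[of k] by (auto simp: fraction_absorbed_def)
  have "ennreal absorbing_fraction * emeasure (weighted d) (\<Union>k. F k) \<le> emeasure (weighted d) ((\<Union>k. F k) \<inter> absorbed)"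
    if d: "\<forall>i<n. 0 < d i" for d
  proof -
    have "ennreal absorbing_fraction * emeasure (weighted d) (\<Union>k. F k)
        = (\<Sum>k. ennreal absorbing_fraction * emeasure (weighted d) (F k))"
      using Fs disj by (subst suminf_emeasure[symmetric]) auto
    also have "\<dots> \<le> (\<Sum>k. emeasure (weighted d) (F k \<inter> absorbed))"
      using F d by (intro suminf_le) (auto simp: fraction_absorbed_def)
    also have "\<dots> = emeasure (weighted d) (\<Union>k. F k \<inter> absorbed)"
      using Fs absorbed_sets disj
      by (intro suminf_emeasure) (auto intro: disjoint_family_subset)
    finally show ?thesis by simp
  qed
  moreover have "(\<Union>k. F k) \<in> sets (lborel_n n)" "(\<Union>k. F k) \<subseteq> chamber" using Fs by auto
  ultimately show ?thesis by (simp only: fraction_absorbed_def) blast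
qed

section \<open>Sets described by overtaking times\<close>

definition first_overtaking :: "nat \<Rightarrow> (nat \<Rightarrow> real) set" where
  "first_overtaking k = {x \<in> chamber. (T a b ^^ k) x \<in> overtaking a b \<and>
    (\<forall>j<k. (T a b ^^ j) x \<notin> overtaking a b)}"

definition late_overtaking :: "nat \<Rightarrow> (nat \<Rightarrow> real) set" where
  "late_overtaking K = {x \<in> chamber. \<exists>k\<ge>K. (T a b ^^ k) x \<in> overtaking a b}"

text \<open>Induction by inverse images: time \<open>0\<close> is the inverse image of the chamber
  within \<open>overtaking\<close>, and each later time is the inverse image of the previous set
  within its complement.\<close>

lemma fraction_absorbed_first_overtaking: "fraction_absorbed (first_overtaking k)"
proof (induction k)
  case 0
  have "first_overtaking 0 = {x \<in> overtaking a b \<inter> space (lborel_n n). T a b x \<in> chamber}"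
    using T_chamber by (auto simp: first_overtaking_def overtaking_def)
  then show ?case using fraction_absorbed_T_vimage[OF order_region_overtaking fraction_absorbed_chamber] by simp
next
  case (Suc k)
  have "first_overtaking (Suc k) =
      {x \<in> (Lambda n - overtaking a b) \<inter> space (lborel_n n). T a b x \<in> first_overtaking k}"
    using T_chamber by (auto simp: first_overtaking_def funpow_Suc_right All_less_Suc2 simp del: funpow.simps)
  then show ?case using fraction_absorbed_T_vimage[OF order_region_not_overtaking Suc] by simp
qed

text \<open>For \<open>K = 0\<close> the set is the disjoint union over first overtaking times;
  raising \<open>K\<close> by one takes the inverse image under \<open>T\<close> in the whole
  chamber.\<close>

lemma fraction_absorbed_late_overtaking: "fraction_absorbed (late_overtaking K)"
proof (induction K)
  case 0
  have "late_overtaking 0 = (\<Union>k. first_overtaking k)"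
    using exists_least_iff[of "\<lambda>k. (T a b ^^ k) _ \<in> overtaking a b"]
    by (auto simp: late_overtaking_def first_overtaking_def)
  moreover have "disjoint_family first_overtaking"
  proof -
    have "first_overtaking j \<inter> first_overtaking k = {}" if "j < k" for j k
      using that by (auto simp: first_overtaking_def)
    then show ?thesis unfolding disjoint_family_on_def by (metis Int_commute linorder_neqE_nat)
  qed
  ultimately show ?case using fraction_absorbed_UN[of first_overtaking] fraction_absorbed_first_overtaking by simp
next
  case (Suc K)
  have "(\<exists>k\<ge>Suc K. (T a b ^^ k) x \<in> overtaking a b) \<longleftrightarrow> (\<exists>k\<ge>K. (T a b ^^ k) (T a b x) \<in> overtaking a b)" for x
    by (metis Suc_le_D Suc_le_mono comp_apply funpow_Suc_right)
  then have "late_overtaking (Suc K) = {x \<in> Lambda n \<inter> space (lborel_n n). T a b x \<in> late_overtaking K}"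
    using T_chamber by (auto simp: late_overtaking_def)
  then show ?case using fraction_absorbed_T_vimage[OF order_region_Lambda Suc] by simp
qed

section \<open>Excess exactly zero is a null event, and the conclusion\<close>

lemma excess_zero_sets: "{x \<in> chamber. excess a b ((T a b ^^ m) x) = 0} \<in> sets (lborel_n n)"
proof -
  have "{x. excess a b x = 0} \<inter> space (lborel_n n) = excess a b -` {0} \<inter> space (lborel_n n)"
    by auto
  then have "{x. excess a b x = 0} \<inter> space (lborel_n n) \<in> sets (lborel_n n)"
    using measurable_sets[OF excess_measurable, of "{0}"] by simp
  then show ?thesis using funpow_T_sets[of "{x. excess a b x = 0}" m] by simp
qed

text \<open>For \<open>m = 0\<close> this is a hyperplane. The branch formula passes from
  \<open>m\<close> to \<open>Suc m\<close> but changes the weight, so the induction is over all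
  \<open>d\<close>.\<close>

lemma emeasure_weighted_excess_zero:
  "emeasure (weighted d) {x \<in> chamber. excess a b ((T a b ^^ m) x) = 0} = 0"
proof (induction m arbitrary: d)
  case 0
  \<comment> \<open>The equation of zero excess solved for \<open>x 0\<close>; the right-hand side
    is free of \<open>x 0\<close> because \<open>n - 1\<close> is not \<open>0\<close>.\<close>
  let ?g = "\<lambda>x. real b * x (n - 1) - (\<Sum>i=1..<n. x i)"
  let ?Z = "{x \<in> chamber. excess a b ((T a b ^^ 0) x) = 0}"
  have "AE x in lborel_n n. x 0 \<noteq> ?g x"
  proof (rule AE_lborel_n_neq)
    show "?g \<in> borel_measurable (lborel_n n)"
      using a by (intro borel_measurable_diff borel_measurable_sum borel_measurable_times
          borel_measurable_const borel_measurable_lborel_n_component) auto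
  qed (use a b in auto)
  moreover have "excess a b x = x 0 - ?g x" for x
    using a sum.atLeast_Suc_lessThan[of 0 n x] by (simp add: excess_def atLeast0LessThan)
  ultimately have "AE x in lborel_n n. weight n d x * indicator ?Z x = 0"
    by (auto elim!: eventually_mono split: split_indicator)
  then have "(\<integral>\<^sup>+x. weight n d x * indicator ?Z x \<partial>lborel_n n) = (\<integral>\<^sup>+x. 0 \<partial>lborel_n n)"
    by (rule nn_integral_cong_AE)
  then show ?case unfolding emeasure_weighted[OF excess_zero_sets] by simp
next
  case (Suc m)
  let ?Z = "{x \<in> chamber. excess a b ((T a b ^^ m) x) = 0}"
  have "{x \<in> chamber. excess a b ((T a b ^^ Suc m) x) = 0}
      = {x \<in> Lambda n \<inter> space (lborel_n n). T a b x \<in> ?Z}"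
    using T_chamber by (auto simp: funpow_Suc_right simp del: funpow.simps)
  then show ?case
    using emeasure_weighted_T_vimage[OF order_region_Lambda excess_zero_sets[of m], of d] Suc by (simp only:) auto
qed

text \<open>The set \<open>?I\<close> of points with infinitely many overtakings has a fixed
  fraction of its mass bounded by that of its absorbed part. That part has excess \<open>0\<close>
  at some time and is null, so \<open>?I\<close> is null, and it contains every unabsorbed point of
  the chamber.\<close>

lemma AE_absorbed: "AE x in lborel_n n. x \<in> Lambda n \<longrightarrow> (\<exists>k. (T a b ^^ k) x \<in> A a b)"
proof -
  let ?\<nu> = "weighted (\<lambda>_. 1)"
  let ?I = "\<Inter>K. late_overtaking K"
  have sets: "late_overtaking K \<in> sets (lborel_n n)" and sub: "late_overtaking K \<subseteq> chamber" for K
    using fraction_absorbed_late_overtaking[of K] by (auto simp: fraction_absorbed_def)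
  have I: "?I \<in> sets (lborel_n n)" using sets by auto
  have "emeasure ?\<nu> chamber = (\<integral>\<^sup>+x. weight n (\<lambda>_. 1) x * indicator (Lambda n) x \<partial>lborel_n n)"
    unfolding emeasure_weighted[OF chamber_sets] by (intro nn_integral_cong) (auto split: split_indicator)
  also have "\<dots> = (\<Prod>j<n. ennreal (1 / (\<Sum>i=j..<n. 1)))"
    by (intro nn_integral_weight_Lambda) auto
  also have "\<dots> = ennreal (\<Prod>j<n. 1 / (\<Sum>i=j..<n. 1))"
    by (intro prod_ennreal divide_nonneg_nonneg sum_nonneg) auto
  also have "\<dots> < \<infinity>" by simp
  \<comment> \<open>Finite mass is what continuity from above demands; Lebesgue measure itself is
    infinite on the chamber.\<close>
  finally have fin: "emeasure ?\<nu> E \<noteq> \<infinity>" if "E \<subseteq> chamber" for E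
    using emeasure_mono[OF that, of ?\<nu>] chamber_sets by (auto simp: top_unique)
  have "(\<lambda>K. emeasure ?\<nu> (late_overtaking K \<inter> absorbed)) \<longlonglongrightarrow> emeasure ?\<nu> (\<Inter>K. late_overtaking K \<inter> absorbed)"
  proof (rule Lim_emeasure_decseq)
    show "decseq (\<lambda>K. late_overtaking K \<inter> absorbed)"
      unfolding decseq_def late_overtaking_def by (auto intro: order_trans)
    show "emeasure ?\<nu> (late_overtaking K \<inter> absorbed) \<noteq> \<infinity>" for K
      using sub[of K] by (intro fin) auto
  qed (use sets absorbed_sets in auto)
  \<comment> \<open>The fraction is known for each \<open>late_overtaking K\<close>; the bound
    passes to their intersection in the limit.\<close>
  moreover have "ennreal absorbing_fraction * emeasure ?\<nu> ?I \<le> emeasure ?\<nu> (late_overtaking K \<inter> absorbed)" for K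
  proof -
    have "emeasure ?\<nu> ?I \<le> emeasure ?\<nu> (late_overtaking K)"
      using sets by (intro emeasure_mono) auto
    then have "ennreal absorbing_fraction * emeasure ?\<nu> ?I \<le> ennreal absorbing_fraction * emeasure ?\<nu> (late_overtaking K)"
      by (rule mult_left_mono) simp
    also have "\<dots> \<le> emeasure ?\<nu> (late_overtaking K \<inter> absorbed)"
      using fraction_absorbed_late_overtaking[of K] by (auto simp: fraction_absorbed_def)
    finally show ?thesis .
  qed
  ultimately have le: "ennreal absorbing_fraction * emeasure ?\<nu> ?I \<le> emeasure ?\<nu> (\<Inter>K. late_overtaking K \<inter> absorbed)"
    by (intro LIMSEQ_le_const) auto
  have "emeasure ?\<nu> (\<Inter>K. late_overtaking K \<inter> absorbed)
      \<le> emeasure ?\<nu> (\<Union>m. {x \<in> chamber. excess a b ((T a b ^^ m) x) = 0})"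
  proof (rule emeasure_mono)
    show "(\<Inter>K. late_overtaking K \<inter> absorbed) \<subseteq> (\<Union>m. {x \<in> chamber. excess a b ((T a b ^^ m) x) = 0})"
    proof
      fix x assume x: "x \<in> (\<Inter>K. late_overtaking K \<inter> absorbed)"
      then obtain m where m: "x \<in> chamber" "(T a b ^^ m) x \<in> A a b" by (auto simp: absorbed_def)
      have "\<exists>k\<ge>K. (T a b ^^ k) x \<in> overtaking a b" for K using x by (auto simp: late_overtaking_def)
      from absorbed_and_overtaking_imp_zero[OF m this]
      show "x \<in> (\<Union>m. {x \<in> chamber. excess a b ((T a b ^^ m) x) = 0})" using m(1) by blast
    qed
  qed (use excess_zero_sets in auto)
  also have "\<dots> = 0"
    using excess_zero_sets by (intro emeasure_UN_eq_0 emeasure_weighted_excess_zero) auto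
  finally have "emeasure ?\<nu> ?I = 0"
    using le absorbing_fraction_pos by (auto simp: ennreal_eq_0_iff)
  then have "AE x in lborel_n n. weight n (\<lambda>_. 1) x * indicator ?I x = 0"
    unfolding emeasure_weighted[OF I] using I by (subst (asm) nn_integral_0_iff_AE) auto
  then show ?thesis
    using AE_space
  proof eventually_elim
    fix x assume x: "weight n (\<lambda>_. 1) x * indicator ?I x = 0" "x \<in> space (lborel_n n)"
    show "x \<in> Lambda n \<longrightarrow> (\<exists>k. (T a b ^^ k) x \<in> A a b)"
    proof (rule ccontr)
      assume "\<not> ?thesis"
      then have ch: "x \<in> chamber" and N: "(T a b ^^ k) x \<notin> A a b" for k using x by auto
      have "\<exists>k\<ge>K. (T a b ^^ k) x \<in> overtaking a b" for K
      proof -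
        \<comment> \<open>The orbit from time \<open>K\<close> on also avoids \<open>A\<close>, so
          an overtaking occurs after every \<open>K\<close>.\<close>
        have "(T a b ^^ k) ((T a b ^^ K) x) \<notin> A a b" for k
          using N[of "k + K"] by (simp add: funpow_add)
        from not_absorbed_imp_overtaking[OF funpow_T_chamber[OF ch] this]
        obtain k where "(T a b ^^ (k + K)) x \<in> overtaking a b" by (auto simp: funpow_add)
        then show ?thesis by (intro exI[of _ "k + K"]) auto
      qed
      then have "x \<in> ?I" using ch by (auto simp: late_overtaking_def)
      \<comment> \<open>The weight vanishes nowhere, so a null set for \<open>?\<nu>\<close> in the
        chamber is Lebesgue null.\<close>
      with x(1) show False by (simp add: weight_def)
    qed
  qed
qed

end

theorem theorem1p1:
  fixes a b :: nat
  assumes "a \<ge> 1" and "b \<ge> 2"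
  shows "AE x in PiM {..<a + b} (\<lambda>_. lborel).
           x \<in> Lambda (a + b) \<longrightarrow> (\<exists>k. (T a b ^^ k) x \<in> A a b)"
  by (rule subtractive.AE_absorbed[OF subtractive.intro[OF assms]])

end
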